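(* Let $n,k$ be positive integers with $n\geq 100k^2$, and let $\mathcal{F},\mathcal{G}\subset\binom{[n]}{k}$ be cross-intersecting families. Then $$|\mathcal{I}(\mathcal{F},\mathcal{G})|\leq |\mathcal{I}(\mathcal{A}_1,\mathcal{A}_2)|.$$
   Context: $[n]=\{1,2,\ldots,n\}$ and $\binom{[n]}{k}$ is the collection of all $k$-element subsets of $[n]$. Families $\mathcal{F},\mathcal{G}\subset\binom{[n]}{k}$ are cross-intersecting if $F\cap G\neq\emptyset$ for all $F\in\mathcal{F}$, $G\in\mathcal{G}$. Define $\mathcal{I}(\mathcal{F},\mathcal{G})=\{F\cap G\colon F\in\mathcal{F},\,G\in\mathcal{G},\,F\neq G\}$. For $T\subset[n]$ let $\mathcal{S}_T=\{S\in\binom{[n]}{k}\colon T\subset S\}$, and write $\mathcal{S}_{pq}=\mathcal{S}_{\{p,q\}}$, $\mathcal{S}_{pqr}=\mathcal{S}_{\{p,q,r\}}$. The two specific (cross-intersecting) families are $$\mathcal{A}_1=\mathcal{S}_{12}\cup\mathcal{S}_{34}\cup\mathcal{S}_{145}\cup\mathcal{S}_{236},\qquad \mathcal{A}_2=\mathcal{S}_{13}\cup\mathcal{S}_{24}\cup\mathcal{S}_{146}\cup\mathcal{S}_{235}.$$ *)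

theory Defs
  imports Main "HOL-Library.Ramsey"
begin

definition cross_intersecting :: "'a set set \<Rightarrow> 'a set set \<Rightarrow> bool" where
  "cross_intersecting \<F> \<G> \<longleftrightarrow> (\<forall>F\<in>\<F>. \<forall>G\<in>\<G>. F \<inter> G \<noteq> {})"

definition cross_inters :: "'a set set \<Rightarrow> 'a set set \<Rightarrow> 'a set set" where
  "cross_inters \<F> \<G> = {F \<inter> G | F G. F \<in> \<F> \<and> G \<in> \<G> \<and> F \<noteq> G}"

definition full_star :: "nat \<Rightarrow> nat \<Rightarrow> nat set \<Rightarrow> nat set set" where
  "full_star n k T = {S \<in> nsets {1..n} k. T \<subseteq> S}"

definition A1 :: "nat \<Rightarrow> nat \<Rightarrow> nat set set" where
  "A1 n k = full_star n k {1,2} \<union> full_star n k {3,4}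
          \<union> full_star n k {1,4,5} \<union> full_star n k {2,3,6}"

definition A2 :: "nat \<Rightarrow> nat \<Rightarrow> nat set set" where
  "A2 n k = full_star n k {1,3} \<union> full_star n k {2,4}
          \<union> full_star n k {1,4,6} \<union> full_star n k {2,3,5}"

end

theory Submission
  imports Defs Complex_Main
begin

text \<open>
  Call a set a cover of a family if it meets every member. Enlarging both families only adds
  intersections, so each of \<open>\<F>\<close>, \<open>\<G>\<close> may be assumed to consist of all \<open>k\<close>-sets covering the other
  one. Every \<open>F \<in> \<F>\<close> then contains a minimal cover \<open>A\<close> of \<open>\<G>\<close> and every \<open>G \<in> \<G>\<close> a minimal cover
  \<open>B\<close> of \<open>\<F>\<close>, and any such \<open>A\<close> and \<open>B\<close> meet (\<open>covers_meet\<close>). The intersections \<open>D = F \<inter> G\<close> are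
  counted through these small sets: \<open>D \<union> A\<close> has at most \<open>k\<close> elements, so a cover of size \<open>a\<close>
  accounts for at most \<open>2\<^sup>a\<close> times as many \<open>D\<close> as there are sets of size at most \<open>k - a\<close>. Passing from
  \<open>a\<close> to \<open>a + 1\<close> costs a factor \<open>100 k\<close> in this number, whereas branching shows that only about \<open>k\<close>
  times as many minimal covers arise. Hence the total is a convergent geometric series, and it
  is a small fraction of its leading term as soon as two elements of each cover are restricted
  to boundedly many choices (\<open>card_sets_near_min_covers\<close>).

  Measure everything by the number \<open>p\<close> of sets of size at most \<open>k - 2\<close>. The sets \<open>D\<close> with
  fewer than \<open>k\<close> elements through one fixed point form a star, and number at most \<open>p\<close>. If small
  covers on one side have no common point, then every cover on the other side contains a
  point of one of them and a point of a second one that avoids the first point, so two of its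
  elements are restricted. If they have a common point, then its star contains many \<open>D\<close>, and
  the \<open>D\<close> outside it have more special covers. Looking at the smallest size up to which the covers
  on one side have no common point, one finds that all \<open>D\<close> lie in at most three stars and a
  remainder, so that their number is at most \<open>(376/96) p < 3.95 p\<close>, with one exception
  (\<open>bound_or_disjoint_pairs\<close>): \<open>{a, b}\<close>, \<open>{c, d}\<close> cover \<open>\<G>\<close> and \<open>{a, c}\<close>, \<open>{b, d}\<close> cover \<open>\<F>\<close>, up to naming the four points.

  In that case four stars are possible. An intersection that avoids \<open>a, b, c, d\<close> comes from
  \<open>F\<close>, \<open>G\<close> that contain \<open>{a, d}\<close> and \<open>{b, c}\<close>, in one of the two orders, and no other of the
  four points. Each order gives a cross-intersecting pair of families of
  \<open>(k - 2)\<close>-sets, whose intersections all share a point or are few (\<open>wedge_star_or_small\<close>). So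
  the best is to have one common point for each order (\<open>two_wedges_bound\<close>). The
  families of the theorem attain this with the points \<open>1, 2, 3, 4\<close> and the additional points
  \<open>5\<close> and \<open>6\<close>, and their four stars alone already have at least \<open>3.95 p\<close> members.
\<close>

section \<open>Sums of binomial coefficients\<close>

definition binom_sum :: "nat \<Rightarrow> nat \<Rightarrow> nat" where
  "binom_sum N j = (\<Sum>i\<le>j. N choose i)"

lemma card_subsets_at_most:
  assumes "finite U"
  shows "card {D. D \<subseteq> U \<and> card D \<le> j} = binom_sum (card U) j"
proof -
  have "{D. D \<subseteq> U \<and> card D \<le> j} = (\<Union>i\<in>{..j}. {D. D \<subseteq> U \<and> card D = i})"
    by auto
  also have "card \<dots> = (\<Sum>i\<in>{..j}. card {D. D \<subseteq> U \<and> card D = i})"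
    using assms by (intro card_UN_disjoint) (auto intro: finite_subset[of _ "Pow U"])
  finally show ?thesis
    using assms by (simp add: binom_sum_def n_subsets)
qed

text \<open>The basic count: the size of a star is the case of a singleton \<open>T\<close>, and the value of the
  extremal configuration is a sum of two such differences.\<close>

lemma card_hitting_subsets:
  assumes "finite U" "T \<subseteq> U"
  shows "card {D. D \<subseteq> U \<and> card D \<le> j \<and> D \<inter> T \<noteq> {}}
           = binom_sum (card U) j - binom_sum (card U - card T) j"
proof -
  have "{D. D \<subseteq> U \<and> card D \<le> j \<and> D \<inter> T \<noteq> {}}
          = {D. D \<subseteq> U \<and> card D \<le> j} - {D. D \<subseteq> U - T \<and> card D \<le> j}"
    by auto
  also have "card \<dots> = card {D. D \<subseteq> U \<and> card D \<le> j} - card {D. D \<subseteq> U - T \<and> card D \<le> j}"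
    using assms by (intro card_Diff_subset) (auto intro: finite_subset[of _ "Pow U"])
  finally show ?thesis
    using assms by (simp add: card_subsets_at_most card_Diff_subset finite_subset)
qed

lemma binom_sum_Suc_Suc: "binom_sum (Suc N) (Suc j) = binom_sum N (Suc j) + binom_sum N j"
  unfolding binom_sum_def by (simp add: sum.atMost_Suc_shift sum.distrib del: sum.atMost_Suc)

lemma binom_sum_mono: "N \<le> N' \<Longrightarrow> binom_sum N j \<le> binom_sum N' j"
  unfolding binom_sum_def by (intro sum_mono binomial_right_mono)

text \<open>This is where \<open>n \<ge> 100 k\<^sup>2\<close> enters: each further element that is prescribed divides
  the number of available sets by \<open>100 k\<close>, which pays for the \<open>k\<close> choices of that element and
  for the constants.\<close>

lemma binom_sum_ratio:
  assumes "100 * k\<^sup>2 \<le> N" "Suc i < k"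
  shows "100 * k * binom_sum N i \<le> binom_sum N (Suc i)"
proof -
  have step: "100 * k * (N choose l) \<le> N choose (Suc l)" if "l \<le> i" for l
  proof -
    have "100 * k * Suc l + l \<le> N"
    proof -
      have "100 * k * Suc l + l \<le> 100 * k * (k - 1) + k"
        using that assms(2) by (intro add_mono mult_mono) auto
      also have "\<dots> \<le> 100 * k * (k - 1) + 100 * k" by simp
      also have "\<dots> = 100 * k\<^sup>2"
        using assms(2) by (cases k) (auto simp: power2_eq_square algebra_simps)
      finally show ?thesis using assms(1) by linarith
    qed
    then have "Suc l * (100 * k * (N choose l)) \<le> (N - l) * (N choose l)"
      by (metis add_le_imp_le_diff mult.assoc mult.commute mult_le_mono1)
    also have "\<dots> = Suc l * (N choose (Suc l))"
      by (simp only: binomial_absorb_comp binomial_absorption)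
    finally show ?thesis by (simp only: Suc_mult_le_cancel1)
  qed
  have "100 * k * binom_sum N i = (\<Sum>l\<le>i. 100 * k * (N choose l))"
    by (simp add: binom_sum_def sum_distrib_left)
  also have "\<dots> \<le> (\<Sum>l\<le>i. N choose (Suc l))"
    using step by (intro sum_mono) auto
  also have "\<dots> \<le> binom_sum N (Suc i)"
    unfolding binom_sum_def by (simp only: sum.atMost_Suc_shift)
  finally show ?thesis .
qed

lemma binom_sum_ratio_power:
  assumes "100 * k\<^sup>2 \<le> N" "i < k" "d \<le> i"
  shows "(100 * k) ^ d * binom_sum N (i - d) \<le> binom_sum N i"
  using assms(3)
proof (induction d)
  case (Suc d)
  have "(100 * k) ^ Suc d * binom_sum N (i - Suc d)
          = (100 * k) ^ d * (100 * k * binom_sum N (i - Suc d))" by simp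
  also have "\<dots> \<le> (100 * k) ^ d * binom_sum N (Suc (i - Suc d))"
    using Suc.prems assms by (intro mult_left_mono binom_sum_ratio) auto
  also have "Suc (i - Suc d) = i - d" using Suc.prems by simp
  finally show ?case using Suc.IH Suc.prems by linarith
qed auto

lemma card_sets_near:
  assumes "finite U" "A \<subseteq> U" "card A \<le> k"
  shows "card {D. D \<subseteq> U \<and> card (D \<union> A) \<le> k} \<le> 2 ^ card A * binom_sum (card U) (k - card A)"
proof -
  let ?Z = "{Z. Z \<subseteq> U \<and> card Z \<le> k - card A}"
  have fA: "finite A" using assms finite_subset by blast
  have fZ: "finite ?Z" using assms(1) by (auto intro: finite_subset[of _ "Pow U"])
  have "{D. D \<subseteq> U \<and> card (D \<union> A) \<le> k} \<subseteq> (\<lambda>(X, Z). X \<union> Z) ` (Pow A \<times> ?Z)"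
  proof
    fix D assume "D \<in> {D. D \<subseteq> U \<and> card (D \<union> A) \<le> k}"
    then have D: "D \<subseteq> U" "card (D \<union> A) \<le> k" by auto
    then have fD: "finite D" using assms(1) finite_subset by blast
    have "card (D \<union> A) = card (D - A) + card A"
      using fA fD by (metis Diff_disjoint Un_Diff_cancel2 card_Un_disjoint finite_Diff inf_commute)
    with D have "D - A \<in> ?Z" by auto
    moreover have "D = (D \<inter> A) \<union> (D - A)" by blast
    ultimately show "D \<in> (\<lambda>(X, Z). X \<union> Z) ` (Pow A \<times> ?Z)"
      by (intro image_eqI[of _ _ "(D \<inter> A, D - A)"]) auto
  qed
  then have "card {D. D \<subseteq> U \<and> card (D \<union> A) \<le> k} \<le> card (Pow A \<times> ?Z)"
    using fA fZ by (meson finite_Pow_iff finite_SigmaI surj_card_le)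
  then show ?thesis
    using fA assms(1) by (simp add: card_cartesian_product card_Pow card_subsets_at_most)
qed

text \<open>Deleting a few points from the ground set changes the counts only by a small fraction, so
  stars in slightly different ground sets can be compared.\<close>

lemma binom_sum_drop:
  assumes "100 * k\<^sup>2 \<le> N" "j < k" "c \<le> 100 * k"
  shows "c * binom_sum N j \<le> c * binom_sum (N - i) j + i * binom_sum N j"
proof (induction i)
  case (Suc i)
  have "c * binom_sum (N - i) j \<le> c * binom_sum (N - Suc i) j + binom_sum N j"
  proof (cases "N - i = 0 \<or> j = 0")
    case True
    then show ?thesis by (auto simp: binom_sum_def)
  next
    case False
    then obtain M j' where M: "N - i = Suc M" "j = Suc j'" by (metis not0_implies_Suc)
    have "binom_sum (N - i) j = binom_sum M j + binom_sum M j'"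
      unfolding M by (rule binom_sum_Suc_Suc)
    moreover have "c * binom_sum M j' \<le> 100 * k * binom_sum N j'"
      using assms(3) M(1) by (intro mult_le_mono binom_sum_mono) auto
    moreover have "100 * k * binom_sum N j' \<le> binom_sum N j"
      unfolding M(2) using assms(1,2) M(2) by (intro binom_sum_ratio) auto
    moreover have "N - Suc i = M" using M(1) by simp
    ultimately show ?thesis by (simp add: distrib_left)
  qed
  then show ?case using Suc by simp
qed simp

section \<open>Minimal covers and the sets close to them\<close>

definition min_covers :: "'a set \<Rightarrow> nat \<Rightarrow> 'a set set \<Rightarrow> 'a set set" where
  "min_covers U k \<H> = {A. A \<subseteq> U \<and> card A \<le> k \<and> (\<forall>H\<in>\<H>. A \<inter> H \<noteq> {})
     \<and> (\<forall>B. B \<subset> A \<longrightarrow> (\<exists>H\<in>\<H>. B \<inter> H = {}))}"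

lemma finite_min_covers: "finite U \<Longrightarrow> finite (min_covers U k \<H>)"
  unfolding min_covers_def by (auto intro: finite_subset[of _ "Pow U"])

text \<open>Branching: a set \<open>S\<close> that is properly contained in a minimal cover is not a cover itself,
  so it misses some member of the family, and the cover contains one of the \<open>k\<close> elements of
  that member.\<close>

lemma card_min_covers_superset:
  assumes "finite U" "\<H> \<subseteq> nsets U k" "finite S"
  shows "card {A \<in> min_covers U k \<H>. S \<subseteq> A \<and> card A = a} \<le> k ^ (a - card S)"
  using assms(3)
proof (induction "a - card S" arbitrary: S)
  case 0
  have "{A \<in> min_covers U k \<H>. S \<subseteq> A \<and> card A = a} \<subseteq> {S}"
  proof
    fix A assume A: "A \<in> {A \<in> min_covers U k \<H>. S \<subseteq> A \<and> card A = a}"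
    then have "finite A" using assms(1) by (auto simp: min_covers_def intro: finite_subset)
    with A 0 show "A \<in> {S}" by (metis (mono_tags, lifting) card_seteq diff_is_0_eq mem_Collect_eq singletonI)
  qed
  then have "card {A \<in> min_covers U k \<H>. S \<subseteq> A \<and> card A = a} \<le> card {S}"
    by (intro card_mono) auto
  then show ?case using 0 by simp
next
  case (Suc d)
  show ?case
  proof (cases "\<forall>H\<in>\<H>. S \<inter> H \<noteq> {}")
    case True
    have "A = S" if "A \<in> min_covers U k \<H>" "S \<subseteq> A" for A
    proof (rule ccontr)
      assume "A \<noteq> S"
      with that(2) have "S \<subset> A" by blast
      with that(1) have "\<exists>H\<in>\<H>. S \<inter> H = {}" by (simp add: min_covers_def)
      with True show False by blast
    qed
    then have "{A \<in> min_covers U k \<H>. S \<subseteq> A \<and> card A = a} = {}"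
      using Suc.hyps(2) by fastforce
    then show ?thesis by (simp only: card.empty)
  next
    case False
    then obtain H where H: "H \<in> \<H>" "S \<inter> H = {}" by blast
    then have fH: "finite H" "card H = k" using assms(2) by (auto simp: nsets_def)
    have "{A \<in> min_covers U k \<H>. S \<subseteq> A \<and> card A = a}
            \<subseteq> (\<Union>v\<in>H. {A \<in> min_covers U k \<H>. insert v S \<subseteq> A \<and> card A = a})"
    proof
      fix A assume A: "A \<in> {A \<in> min_covers U k \<H>. S \<subseteq> A \<and> card A = a}"
      then have "A \<inter> H \<noteq> {}" using H(1) by (simp add: min_covers_def)
      then obtain v where "v \<in> A" "v \<in> H" by blast
      with A show "A \<in> (\<Union>v\<in>H. {A \<in> min_covers U k \<H>. insert v S \<subseteq> A \<and> card A = a})"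
        by auto
    qed
    then have "card {A \<in> min_covers U k \<H>. S \<subseteq> A \<and> card A = a}
        \<le> card (\<Union>v\<in>H. {A \<in> min_covers U k \<H>. insert v S \<subseteq> A \<and> card A = a})"
      using fH finite_min_covers[OF assms(1)] by (intro card_mono) auto
    also have "\<dots> \<le> (\<Sum>v\<in>H. card {A \<in> min_covers U k \<H>. insert v S \<subseteq> A \<and> card A = a})"
      using fH by (intro card_UN_le) auto
    also have "\<dots> \<le> (\<Sum>v\<in>H. k ^ d)"
    proof (rule sum_mono)
      fix v assume "v \<in> H"
      with H(2) have "v \<notin> S" by blast
      then have "card (insert v S) = Suc (card S)" using Suc.prems by simp
      then have d: "d = a - card (insert v S)" using Suc.hyps(2) by simp
      show "card {A \<in> min_covers U k \<H>. insert v S \<subseteq> A \<and> card A = a} \<le> k ^ d"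
        using Suc.hyps(1)[OF d] Suc.prems d by simp
    qed
    also have "\<dots> = k ^ (a - card S)" using fH Suc.hyps(2)[symmetric] by simp
    finally show ?thesis .
  qed
qed

text \<open>The arithmetic of one term of the geometric series: \<open>c\<close> covers of one size, each with \<open>w * q\<close>
  nearby sets, contribute a share of \<open>p\<close> that shrinks by the factor \<open>4 / 100\<close> when the size
  grows by one.\<close>

lemma level_weight:
  fixes c g k M p q w d :: nat
  assumes "c \<le> g * k ^ Suc d" "g * w \<le> M * 4 ^ d" "(100 * k) ^ Suc d * q \<le> star_bound"
  shows "real (c * (w * q)) \<le> real (M * star_bound) / 100 * (1 / 25) ^ d"
proof -
  have "c * (w * q) * 100 ^ Suc d \<le> g * k ^ Suc d * (w * q) * 100 ^ Suc d"
    using assms(1) by (intro mult_right_mono) auto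
  also have "\<dots> = g * w * ((100 * k) ^ Suc d * q)"
    unfolding power_mult_distrib by (simp only: ac_simps)
  also have "\<dots> \<le> (M * 4 ^ d) * star_bound"
    using assms(2,3) by (rule mult_mono) simp_all
  finally have "real (c * (w * q) * 100 ^ Suc d) \<le> real (M * 4 ^ d * star_bound)"
    by (simp only: of_nat_le_iff)
  then have "real (c * (w * q)) * 100 ^ Suc d \<le> real (M * star_bound) * 4 ^ d"
    by (simp only: of_nat_mult of_nat_power of_nat_numeral ac_simps)
  then have "real (c * (w * q)) \<le> real (M * star_bound) * 4 ^ d / 100 ^ Suc d"
    by (subst pos_le_divide_eq) simp_all
  also have "\<dots> = real (M * star_bound) / 100 * (4 ^ d / 100 ^ d)"
    by simp
  also have "(4::real) ^ d / 100 ^ d = (4 / 100) ^ d"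
    by (simp only: power_divide)
  finally show ?thesis by simp
qed

text \<open>The main counting tool. The sets in \<open>\<S>\<close> are seeds: each cover in \<open>\<A>\<close> contains one of them, and
  branching needs to choose only the other elements. The factor \<open>2 ^ a\<close> counts the possible
  parts \<open>D \<inter> A\<close>. The lower bound \<open>L\<close> on the sizes allows the number \<open>s\<close> of seeds to depend on a
  quantity that is at most the size of every cover. The constant 96 is the value of
  \<open>100 (1 - 1/25)\<close>, coming from the sum of the geometric series with ratio \<open>1/25\<close>.\<close>

lemma card_sets_near_min_covers:
  assumes U: "finite U" "100 * k\<^sup>2 \<le> card U"
    and \<H>: "\<H> \<subseteq> nsets U k"
    and \<A>: "\<A> \<subseteq> min_covers U k \<H>" "\<And>A. A \<in> \<A> \<Longrightarrow> j < card A \<and> L \<le> card A"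
    and j: "0 < j"
    and \<S>: "finite \<S>" "card \<S> \<le> s" "\<And>S. S \<in> \<S> \<Longrightarrow> finite S \<and> card S = j"
      "\<And>A. A \<in> \<A> \<Longrightarrow> \<exists>S\<in>\<S>. S \<subseteq> A"
    and M: "\<And>a. j < a \<Longrightarrow> L \<le> a \<Longrightarrow> s * 2 ^ a \<le> M * 4 ^ (a - Suc j)"
    and \<D>: "\<And>D. D \<in> \<D> \<Longrightarrow> D \<subseteq> U \<and> (\<exists>A\<in>\<A>. card (D \<union> A) \<le> k)"
  shows "96 * card \<D> \<le> M * binom_sum (card U) (k - j)"
proof -
  let ?P = "\<lambda>i. binom_sum (card U) i"
  let ?near = "\<lambda>A. {D. D \<subseteq> U \<and> card (D \<union> A) \<le> k}"
  let ?s = "\<lambda>a. if L \<le> a then s else 0"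
  have f\<A>: "finite \<A>" using \<A>(1) finite_min_covers[OF U(1)] finite_subset by blast
  have fnear: "finite (?near A)" for A using U(1) by (auto intro: finite_subset[of _ "Pow U"])
  have in\<A>: "A \<subseteq> U" "card A \<le> k" "card A \<in> {Suc j..k}" if "A \<in> \<A>" for A
    using \<A> that by (auto simp: min_covers_def Suc_le_eq)
  have level: "card {A \<in> \<A>. card A = a} \<le> ?s a * k ^ (a - j)" for a
  proof (cases "L \<le> a")
    case True
    let ?C = "\<lambda>S. {A \<in> min_covers U k \<H>. S \<subseteq> A \<and> card A = a}"
    have "{A \<in> \<A>. card A = a} \<subseteq> (\<Union>S\<in>\<S>. ?C S)"
    proof
      fix A assume A: "A \<in> {A \<in> \<A>. card A = a}"
      with \<S>(4) obtain S where "S \<in> \<S>" "S \<subseteq> A" by blast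
      with A \<A>(1) show "A \<in> (\<Union>S\<in>\<S>. ?C S)" by blast
    qed
    then have "card {A \<in> \<A>. card A = a} \<le> card (\<Union>S\<in>\<S>. ?C S)"
      using \<S>(1) finite_min_covers[OF U(1)] by (intro card_mono) auto
    also have "\<dots> \<le> (\<Sum>S\<in>\<S>. card (?C S))" using \<S>(1) by (intro card_UN_le) auto
    also have "\<dots> \<le> (\<Sum>S\<in>\<S>. k ^ (a - j))"
      using \<S>(3) card_min_covers_superset[OF U(1) \<H>] by (intro sum_mono) force
    also have "\<dots> \<le> s * k ^ (a - j)" using \<S>(2) by simp
    finally show ?thesis using True by simp
  next
    case False
    then have "{A \<in> \<A>. card A = a} = {}" using \<A>(2) by auto
    then show ?thesis by (simp only: card.empty)
  qed
  have "card \<D> \<le> card (\<Union>A\<in>\<A>. ?near A)"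
    using \<D> f\<A> fnear by (intro card_mono) auto
  also have "\<dots> \<le> (\<Sum>A\<in>\<A>. card (?near A))" using f\<A> by (intro card_UN_le) auto
  also have "\<dots> \<le> (\<Sum>A\<in>\<A>. 2 ^ card A * ?P (k - card A))"
    using in\<A> by (intro sum_mono card_sets_near U) auto
  also have "\<dots> = (\<Sum>a\<in>{Suc j..k}. \<Sum>A\<in>{A \<in> \<A>. card A = a}. 2 ^ card A * ?P (k - card A))"
    using f\<A> in\<A> by (intro sum.group[symmetric]) auto
  also have "\<dots> = (\<Sum>a\<in>{Suc j..k}. card {A \<in> \<A>. card A = a} * (2 ^ a * ?P (k - a)))"
    by simp
  finally have "real (card \<D>) \<le> real (\<Sum>a\<in>{Suc j..k}. card {A \<in> \<A>. card A = a} * (2 ^ a * ?P (k - a)))"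
    by (simp only: of_nat_le_iff)
  also have "\<dots> = (\<Sum>a\<in>{Suc j..k}. real (card {A \<in> \<A>. card A = a} * (2 ^ a * ?P (k - a))))"
    by (simp only: of_nat_sum)
  also have "\<dots> \<le> (\<Sum>a\<in>{Suc j..k}. real (M * ?P (k - j)) / 100 * (1 / 25) ^ (a - Suc j))"
  proof (rule sum_mono)
    fix a assume a: "a \<in> {Suc j..k}"
    define d where "d = a - Suc j"
    have ad: "a - j = Suc d" "a = Suc (d + j)" "k - a = k - j - Suc d" using a by (auto simp: d_def)
    have *: "(100 * k) ^ Suc d * ?P (k - a) \<le> ?P (k - j)"
      unfolding ad(3) using a j by (intro binom_sum_ratio_power[OF U(2)]) (auto simp: d_def)
    have **: "?s a * 2 ^ a \<le> M * 4 ^ d"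
      using M[of a] a by (simp add: d_def)
    have ***: "card {A \<in> \<A>. card A = a} \<le> ?s a * k ^ Suc d"
      using level[of a] unfolding ad(1) .
    show "real (card {A \<in> \<A>. card A = a} * (2 ^ a * ?P (k - a)))
        \<le> real (M * ?P (k - j)) / 100 * (1 / 25) ^ (a - Suc j)"
      using level_weight[OF *** ** *] unfolding d_def .
  qed
  also have "\<dots> = real (M * ?P (k - j)) / 100 * (\<Sum>a\<in>{Suc j..k}. (1 / 25) ^ (a - Suc j))"
    by (simp only: sum_distrib_left)
  also have "(\<Sum>a\<in>{Suc j..k}. (1 / 25 :: real) ^ (a - Suc j)) = (\<Sum>d<k - j. (1 / 25) ^ d)"
    by (rule sum.reindex_bij_witness[of _ "\<lambda>d. d + Suc j" "\<lambda>a. a - Suc j"]) auto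
  also have "(\<Sum>d<k - j. (1 / 25 :: real) ^ d) = (1 - (1 / 25) ^ (k - j)) / (24 / 25)"
    by (simp add: sum_gp_strict)
  finally have "real (card \<D>)
      \<le> real (M * ?P (k - j)) / 100 * ((1 - (1 / 25) ^ (k - j)) / (24 / 25))" .
  also have "\<dots> \<le> real (M * ?P (k - j)) / 100 * (1 / (24 / 25))"
    by (intro mult_left_mono divide_right_mono) simp_all
  finally have "real (96 * card \<D>) \<le> real (M * ?P (k - j))" by simp
  then show ?thesis by (simp only: of_nat_le_iff)
qed

text \<open>Sets meeting every member of a family without a common point can be started in two steps: one
  element in a fixed member, and a second one in a member that avoids the first element.\<close>

lemma two_element_seeds:
  assumes "\<And>v. \<exists>H\<in>\<H>. v \<notin> H" "\<And>H. H \<in> \<H> \<Longrightarrow> finite H \<and> card H \<le> L"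
    and "\<And>A H. A \<in> \<A> \<Longrightarrow> H \<in> \<H> \<Longrightarrow> A \<inter> H \<noteq> {}"
  obtains \<S> where "finite \<S>" "card \<S> \<le> L * L" "\<And>S. S \<in> \<S> \<Longrightarrow> finite S \<and> card S = 2"
    "\<And>A. A \<in> \<A> \<Longrightarrow> \<exists>S\<in>\<S>. S \<subseteq> A"
proof -
  obtain H where H: "\<And>v. H v \<in> \<H>" "\<And>v. v \<notin> H v" using assms(1) by metis
  obtain H0 where H0: "H0 \<in> \<H>" using assms(1) by blast
  let ?X = "SIGMA v:H0. H v"
  let ?S = "(\<lambda>(v, w). {v, w}) ` ?X"
  have fin: "finite H0" "finite (H v)" for v using assms(2) H0 H by auto
  have "card ?S \<le> card ?X" using fin by (intro card_image_le) auto
  also have "\<dots> = (\<Sum>v\<in>H0. card (H v))" using fin by simp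
  also have "\<dots> \<le> (\<Sum>v\<in>H0. L)" using assms(2) H by (intro sum_mono) auto
  also have "\<dots> \<le> L * L" using assms(2)[OF H0] by simp
  finally have 1: "card ?S \<le> L * L" .
  have 2: "finite ?S" using fin by auto
  have 3: "finite S \<and> card S = 2" if S: "S \<in> ?S" for S
  proof -
    obtain v w where "w \<in> H v" "S = {v, w}" using S by auto
    then show ?thesis using H(2)[of v] by (auto simp: card_insert_if)
  qed
  have 4: "\<exists>S\<in>?S. S \<subseteq> A" if A: "A \<in> \<A>" for A
  proof -
    obtain v where v: "v \<in> A" "v \<in> H0" using assms(3)[OF A H0] by blast
    obtain w where w: "w \<in> A" "w \<in> H v" using assms(3)[OF A H(1)] by blast
    have "{v, w} \<in> ?S" using v w by (intro image_eqI[of _ _ "(v, w)"]) auto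
    then show ?thesis using v w by (intro bexI[of _ "{v, w}"]) auto
  qed
  show ?thesis using that[of ?S, OF 2 1 3 4] .
qed

lemma two_element_seeds_through:
  assumes "finite H" "card H \<le> L" "y \<notin> H" "\<And>A. A \<in> \<A> \<Longrightarrow> y \<in> A \<and> A \<inter> H \<noteq> {}"
  obtains \<S> where "finite \<S>" "card \<S> \<le> L" "\<And>S. S \<in> \<S> \<Longrightarrow> finite S \<and> card S = 2"
    "\<And>A. A \<in> \<A> \<Longrightarrow> \<exists>S\<in>\<S>. S \<subseteq> A"
proof -
  let ?S = "(\<lambda>w. {y, w}) ` H"
  have 2: "finite ?S" using assms(1) by simp
  have 1: "card ?S \<le> L" using card_image_le[OF assms(1)] assms(2) le_trans by blast
  have 3: "finite S \<and> card S = 2" if "S \<in> ?S" for S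
    using that assms(3) by (auto simp: card_insert_if)
  have 4: "\<exists>S\<in>?S. S \<subseteq> A" if A: "A \<in> \<A>" for A
  proof -
    obtain w where "w \<in> A" "w \<in> H" "y \<in> A" using assms(4)[OF A] by blast
    then show ?thesis by (intro bexI[of _ "{y, w}"]) auto
  qed
  show ?thesis using that[of ?S, OF 2 1 3 4] .
qed

text \<open>The following three estimates say that up to \<open>a\<^sup>2\<close>, \<open>a\<close>, or constantly many seeds are few
  enough for the geometric series, and give the corresponding constants.\<close>

lemma square_le_power: "3 \<le> (a::nat) \<Longrightarrow> a * a * 2 ^ a \<le> 72 * 4 ^ (a - 3)"
proof (induction a rule: nat_induct_at_least)
  case base show ?case by simp
next
  case (Suc a)
  have "Suc a * Suc a \<le> 2 * (a * a)"
  proof -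
    have "3 * a \<le> a * a" using Suc(1) by (rule mult_right_mono) simp
    then have "Suc (a + a) \<le> a * a" using Suc(1) by linarith
    then show ?thesis by simp
  qed
  then have "Suc a * Suc a * 2 ^ Suc a \<le> 2 * (a * a) * 2 ^ Suc a" by (rule mult_right_mono) simp
  also have "\<dots> = 4 * (a * a * 2 ^ a)" by simp
  also have "\<dots> \<le> 4 * (72 * 4 ^ (a - 3))" using Suc by simp
  also have "\<dots> = 72 * 4 ^ (Suc a - 3)"
    unfolding Suc_diff_le[OF Suc(1)] by simp
  finally show ?case .
qed

lemma linear_le_power: "Suc j \<le> a \<Longrightarrow> j > 0 \<Longrightarrow> a * 2 ^ a \<le> Suc j * 2 ^ Suc j * 4 ^ (a - Suc j)"
proof (induction a rule: nat_induct_at_least)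
  case base show ?case by simp
next
  case (Suc a)
  have "Suc a * 2 ^ Suc a \<le> 4 * (a * 2 ^ a)" using Suc by simp
  also have "\<dots> \<le> 4 * (Suc j * 2 ^ Suc j * 4 ^ (a - Suc j))" using Suc by simp
  also have "\<dots> = Suc j * 2 ^ Suc j * 4 ^ (Suc a - Suc j)"
    unfolding Suc_diff_le[OF Suc(1)] by simp
  finally show ?case .
qed

lemma const_le_power: "3 \<le> (a::nat) \<Longrightarrow> (s::nat) * 2 ^ a \<le> 8 * s * 4 ^ (a - 3)"
proof (induction a rule: nat_induct_at_least)
  case base show ?case by simp
next
  case (Suc a)
  have "s * 2 ^ Suc a \<le> 4 * (s * 2 ^ a)" by simp
  also have "\<dots> \<le> 4 * (8 * s * 4 ^ (a - 3))" using Suc by simp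
  also have "\<dots> = 8 * s * 4 ^ (Suc a - 3)"
    unfolding Suc_diff_le[OF Suc(1)] by simp
  finally show ?case .
qed

section \<open>Saturated cross-intersecting pairs\<close>

text \<open>A pair of cross-intersecting families to which no further set can be added. Maximality is what
  forces minimal covers of the two families to meet.\<close>

locale saturated_pair =
  fixes U :: "'a set" and k :: nat and \<F> \<G> :: "'a set set"
  assumes finite_U: "finite U" and card_U: "100 * k\<^sup>2 \<le> card U"
    and F_eq: "\<F> = {F \<in> nsets U k. \<forall>G\<in>\<G>. F \<inter> G \<noteq> {}}"
    and G_eq: "\<G> = {G \<in> nsets U k. \<forall>F\<in>\<F>. G \<inter> F \<noteq> {}}"
    and F_nonempty: "\<F> \<noteq> {}" and G_nonempty: "\<G> \<noteq> {}"
begin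

text \<open>The minimal covers of \<open>\<G>\<close> are named after \<open>\<F>\<close>, since they are the minimal sets that
  generate \<open>\<F>\<close>: a \<open>k\<close>-set belongs to \<open>\<F>\<close> if and only if it contains one of them.\<close>

abbreviation "CF \<equiv> min_covers U k \<G>"
abbreviation "CG \<equiv> min_covers U k \<F>"

lemma swapped: "saturated_pair U k \<G> \<F>"
  by (rule saturated_pair.intro[OF finite_U card_U G_eq F_eq G_nonempty F_nonempty])

lemma F_sub: "\<F> \<subseteq> nsets U k"
  unfolding F_eq by (rule Collect_subset)

lemma G_sub: "\<G> \<subseteq> nsets U k"
  unfolding G_eq by (rule Collect_subset)

lemma members_meet: "F \<in> \<F> \<Longrightarrow> G \<in> \<G> \<Longrightarrow> F \<inter> G \<noteq> {}"
  using F_eq by blast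

lemma k_pos: "0 < k"
proof (rule ccontr)
  assume "\<not> 0 < k"
  then have "\<F> \<subseteq> {{}}" using F_sub by (auto simp: nsets_def)
  then show False using members_meet F_nonempty G_nonempty by fastforce
qed

lemma two_k_le: "2 * k \<le> card U"
proof -
  have "2 * k \<le> 100 * (k * k)" using k_pos by simp
  then show ?thesis using card_U unfolding power2_eq_square by linarith
qed

lemma ex_cover_subset:
  assumes "F \<in> \<F>" shows "\<exists>A\<in>CF. A \<subseteq> F"
proof -
  have F: "finite F" "F \<subseteq> U" "card F = k" using assms F_sub by (auto simp: nsets_def)
  let ?Q = "\<lambda>A. A \<subseteq> F \<and> (\<forall>G\<in>\<G>. A \<inter> G \<noteq> {})"
  have "?Q F" using assms members_meet by blast
  then obtain A where A: "?Q A" "\<And>B. ?Q B \<Longrightarrow> card A \<le> card B"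
    using ex_has_least_nat[of ?Q F card] by blast
  have fA: "finite A" using A F finite_subset by blast
  have "\<exists>G\<in>\<G>. B \<inter> G = {}" if "B \<subset> A" for B
    using A(2)[of B] A(1) that psubset_card_mono[OF fA that] by fastforce
  moreover have "card A \<le> k" using A F card_mono by metis
  ultimately have "A \<in> CF" using A F unfolding min_covers_def by blast
  then show ?thesis using A by blast
qed

lemma ex_superset_avoiding:
  assumes "A \<subseteq> U" "B \<subseteq> U" "card A \<le> k" "card B \<le> k" "A \<inter> B = {}"
  shows "\<exists>F\<in>nsets U k. A \<subseteq> F \<and> F \<inter> B = {}"
proof -
  have f: "finite A" "finite B" using assms finite_U finite_subset by blast+
  have "card (U - (A \<union> B)) = card U - (card A + card B)"
    using assms f finite_U by (simp add: card_Diff_subset card_Un_disjoint)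
  then have "k - card A \<le> card (U - (A \<union> B))" using two_k_le assms by linarith
  then obtain C where C: "C \<subseteq> U - (A \<union> B)" "card C = k - card A" "finite C"
    using obtain_subset_with_card_n by metis
  have "card (A \<union> C) = k" using C f assms by (subst card_Un_disjoint) auto
  then show ?thesis using C f assms by (intro bexI[of _ "A \<union> C"]) (auto simp: nsets_def)
qed

text \<open>Disjoint covers \<open>A\<close>, \<open>B\<close> would be contradictory: there is room to extend \<open>A\<close> to a \<open>k\<close>-set that
  avoids \<open>B\<close>, this set belongs to \<open>\<F>\<close> by maximality, and \<open>B\<close> must meet it.\<close>

lemma covers_meet:
  assumes "A \<in> CF" "B \<in> CG" shows "A \<inter> B \<noteq> {}"
proof
  assume *: "A \<inter> B = {}"
  have A: "A \<subseteq> U" "card A \<le> k" "\<forall>G\<in>\<G>. A \<inter> G \<noteq> {}"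
    and B: "B \<subseteq> U" "card B \<le> k" "\<forall>F\<in>\<F>. B \<inter> F \<noteq> {}"
    using assms by (auto simp: min_covers_def)
  obtain F where F: "F \<in> nsets U k" "A \<subseteq> F" "F \<inter> B = {}"
    using ex_superset_avoiding[OF A(1) B(1) A(2) B(2) *] by blast
  then have "\<forall>G\<in>\<G>. F \<inter> G \<noteq> {}" using A(3) by blast
  then have "F \<in> \<F>" using F(1) F_eq by blast
  then show False using B(3) F(3) by blast
qed

text \<open>The information about \<open>D = F \<inter> G\<close> that the counting uses, where \<open>A \<subseteq> F\<close> and \<open>B \<subseteq> G\<close> are
  minimal covers. The members \<open>F\<close> and \<open>G\<close> themselves can be forgotten.\<close>

definition trace :: "'a set \<Rightarrow> 'a set \<Rightarrow> 'a set \<Rightarrow> bool" where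
  "trace A B D \<longleftrightarrow> A \<in> CF \<and> B \<in> CG \<and> D \<subseteq> U \<and> A \<inter> B \<subseteq> D \<and> D \<inter> A \<noteq> {} \<and> D \<inter> B \<noteq> {}
     \<and> card (D \<union> A) \<le> k \<and> card (D \<union> B) \<le> k"

end

lemma (in saturated_pair) ex_trace:
  assumes "F \<in> \<F>" "G \<in> \<G>" shows "\<exists>A B. trace A B (F \<inter> G)"
proof -
  obtain A where A: "A \<in> CF" "A \<subseteq> F" using ex_cover_subset assms by blast
  obtain B where B: "B \<in> CG" "B \<subseteq> G"
    using saturated_pair.ex_cover_subset[OF swapped] assms by blast
  have F: "finite F" "card F = k" "F \<subseteq> U" and G: "finite G" "card G = k"
    using assms F_sub G_sub by (auto simp: nsets_def)
  have "card (F \<inter> G \<union> A) \<le> card F" using A(2) by (intro card_mono F(1)) blast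
  moreover have "card (F \<inter> G \<union> B) \<le> card G" using B(2) by (intro card_mono G(1)) blast
  moreover have "A \<inter> G \<noteq> {}" "B \<inter> F \<noteq> {}" using A(1) B(1) assms by (auto simp: min_covers_def)
  then have "F \<inter> G \<inter> A \<noteq> {}" "F \<inter> G \<inter> B \<noteq> {}" using A(2) B(2) by blast+
  moreover have "A \<inter> B \<subseteq> F \<inter> G" "F \<inter> G \<subseteq> U" using A(2) B(2) F(3) by blast+
  ultimately have "trace A B (F \<inter> G)"
    unfolding trace_def using A(1) B(1) F(2) G(2) by simp
  then show ?thesis by blast
qed

lemma (in saturated_pair) cross_inters_trace:
  assumes "D \<in> cross_inters \<F> \<G>"
  obtains A B where "trace A B D" "card D < k"
proof -
  obtain F G where FG: "F \<in> \<F>" "G \<in> \<G>" "F \<noteq> G" "D = F \<inter> G"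
    using assms unfolding cross_inters_def by blast
  have F: "finite F" "card F = k" and G: "finite G" "card G = k"
    using FG F_sub G_sub by (auto simp: nsets_def)
  have "\<not> F \<subseteq> G" using F G FG(3) card_subset_eq[of G F] by auto
  then have "F \<inter> G \<subset> F" by blast
  then have "card D < k" using F FG(4) psubset_card_mono by blast
  then show ?thesis using that ex_trace[OF FG(1,2)] FG(4) by blast
qed

lemma ex_saturated_pair:
  assumes "finite U" "100 * k\<^sup>2 \<le> card U" "\<F> \<subseteq> nsets U k" "\<G> \<subseteq> nsets U k"
    and "cross_intersecting \<F> \<G>" "\<F> \<noteq> {}" "\<G> \<noteq> {}"
  obtains \<F>' \<G>' where "\<F> \<subseteq> \<F>'" "\<G> \<subseteq> \<G>'" "saturated_pair U k \<F>' \<G>'"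
proof -
  define \<F>' where "\<F>' = {F \<in> nsets U k. \<forall>G\<in>\<G>. F \<inter> G \<noteq> {}}"
  define \<G>' where "\<G>' = {G \<in> nsets U k. \<forall>F\<in>\<F>'. G \<inter> F \<noteq> {}}"
  have F: "\<F> \<subseteq> \<F>'"
    using assms(3,5) unfolding \<F>'_def cross_intersecting_def by blast
  have G: "\<G> \<subseteq> \<G>'"
  proof
    fix G assume G: "G \<in> \<G>"
    have "G \<inter> F \<noteq> {}" if "F \<in> \<F>'" for F
      using that G unfolding \<F>'_def by blast
    then show "G \<in> \<G>'" using G assms(4) unfolding \<G>'_def by blast
  qed
  have "\<F>' = {F \<in> nsets U k. \<forall>G\<in>\<G>'. F \<inter> G \<noteq> {}}" (is "_ = ?R")
  proof
    show "\<F>' \<subseteq> ?R"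
    proof
      fix F assume F: "F \<in> \<F>'"
      have "F \<inter> G \<noteq> {}" if "G \<in> \<G>'" for G using that F unfolding \<G>'_def by blast
      moreover have "F \<in> nsets U k" using F unfolding \<F>'_def by blast
      ultimately show "F \<in> ?R" by blast
    qed
    show "?R \<subseteq> \<F>'"
    proof
      fix F assume F: "F \<in> ?R"
      then have "\<forall>G\<in>\<G>. F \<inter> G \<noteq> {}" using G by blast
      then show "F \<in> \<F>'" using F unfolding \<F>'_def by blast
    qed
  qed
  moreover have "\<F>' \<noteq> {}" "\<G>' \<noteq> {}" using F G assms(6,7) by blast+
  ultimately have "saturated_pair U k \<F>' \<G>'"
    by (intro saturated_pair.intro[OF assms(1,2)]) (simp_all only: \<G>'_def not_False_eq_True)
  then show ?thesis using that F G by blast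
qed

section \<open>Pairs of families without the extremal pattern\<close>

lemma card_Un_scaled:
  fixes a b q :: nat
  assumes "96 * card X \<le> a * q" "96 * card Y \<le> b * q"
  shows "96 * card (X \<union> Y) \<le> (a + b) * q"
proof -
  have "96 * card (X \<union> Y) \<le> 96 * card X + 96 * card Y" using card_Un_le[of X Y] by simp
  then show ?thesis using assms by (simp add: algebra_simps)
qed

text \<open>Pairwise intersecting edges without a common vertex form a triangle.\<close>

lemma intersecting_pairs_triangle:
  assumes pairs: "\<And>e. e \<in> E \<Longrightarrow> card e = 2"
    and meet: "\<And>e f. e \<in> E \<Longrightarrow> f \<in> E \<Longrightarrow> e \<inter> f \<noteq> {}"
    and no_center: "\<And>x. \<exists>e\<in>E. x \<notin> e"
  obtains T where "finite T" "card T \<le> 3" "\<And>e. e \<in> E \<Longrightarrow> e \<subseteq> T"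
proof -
  obtain e where e: "e \<in> E" using no_center by blast
  then obtain a b where ab: "e = {a, b}" "a \<noteq> b" using pairs card_2_iff by metis
  obtain f where f: "f \<in> E" "a \<notin> f" using no_center by blast
  then have bf: "b \<in> f" using meet[OF e f(1)] ab by blast
  obtain c where c: "f = {b, c}" "c \<noteq> b" "c \<noteq> a"
    using pairs[OF f(1)] bf f(2) card_2_iff[of f] by auto
  obtain g where g: "g \<in> E" "b \<notin> g" using no_center by blast
  have "a \<in> g" "c \<in> g" using meet[OF e g(1)] meet[OF f(1) g(1)] ab c g(2) by auto
  have fin_card: "finite h" if "h \<in> E" for h using pairs[OF that] card.infinite by fastforce
  have gg: "g = {a, c}"
    using \<open>a \<in> g\<close> \<open>c \<in> g\<close> c pairs[OF g(1)] fin_card[OF g(1)] card_seteq[of g "{a, c}"]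
    by (auto simp: card_insert_if)
  have "h \<subseteq> {a, b, c}" if h: "h \<in> E" for h
  proof -
    obtain u v where uv: "h = {u, v}" using pairs[OF h] card_2_iff by metis
    show ?thesis
      using meet[OF h e] meet[OF h f(1)] meet[OF h g(1)] ab c gg uv by auto
  qed
  then show ?thesis by (rule that[of "{a, b, c}", rotated 2]) (auto simp: card_insert_if)
qed

context saturated_pair
begin

abbreviation "star_bound \<equiv> binom_sum (card U) (k - 2)"

text \<open>From here on, all counts are expressed in multiples of \<open>star_bound\<close>, scaled by 96 to stay within
  the natural numbers.\<close>

lemma card_traces_near:
  assumes \<A>: "\<And>A. A \<in> \<A> \<Longrightarrow> A \<in> CF \<and> 2 < card A \<and> L \<le> card A"
    and \<S>: "finite \<S>" "card \<S> \<le> s" "\<And>S. S \<in> \<S> \<Longrightarrow> finite S \<and> card S = 2"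
      "\<And>A. A \<in> \<A> \<Longrightarrow> \<exists>S\<in>\<S>. S \<subseteq> A"
    and M: "\<And>a. 3 \<le> a \<Longrightarrow> L \<le> a \<Longrightarrow> s * 2 ^ a \<le> M * 4 ^ (a - 3)"
  shows "96 * card {D. \<exists>A\<in>\<A>. \<exists>B. trace A B D} \<le> M * star_bound"
proof (rule card_sets_near_min_covers[OF finite_U card_U G_sub])
  show "\<A> \<subseteq> CF" using \<A> by blast
  show "2 < card A \<and> L \<le> card A" if "A \<in> \<A>" for A using \<A>[OF that] by blast
  show "D \<subseteq> U \<and> (\<exists>A\<in>\<A>. card (D \<union> A) \<le> k)" if "D \<in> {D. \<exists>A\<in>\<A>. \<exists>B. trace A B D}" for D
    using that unfolding trace_def by blast
  show "s * 2 ^ a \<le> M * 4 ^ (a - Suc 2)" if "2 < a" "L \<le> a" for a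
    using M[of a] that by simp
qed (use \<S> in auto)

lemma trace_swap: "saturated_pair.trace U k \<G> \<F> B A D \<longleftrightarrow> trace A B D"
  unfolding trace_def saturated_pair.trace_def[OF swapped] by (auto simp: Int_commute)

lemma card_traces_near':
  assumes "\<And>B. B \<in> \<B> \<Longrightarrow> B \<in> CG \<and> 2 < card B \<and> L \<le> card B"
    and "finite \<S>" "card \<S> \<le> s" "\<And>S. S \<in> \<S> \<Longrightarrow> finite S \<and> card S = 2"
      "\<And>B. B \<in> \<B> \<Longrightarrow> \<exists>S\<in>\<S>. S \<subseteq> B"
    and "\<And>a. 3 \<le> a \<Longrightarrow> L \<le> a \<Longrightarrow> s * 2 ^ a \<le> M * 4 ^ (a - 3)"
  shows "96 * card {D. \<exists>B\<in>\<B>. \<exists>A. trace A B D} \<le> M * star_bound"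
  using saturated_pair.card_traces_near[OF swapped assms] unfolding trace_swap by blast

lemma finite_traces: "finite {D. \<exists>A\<in>\<A>. \<exists>B. trace A B D}" "finite {D. \<exists>B\<in>\<B>. \<exists>A. trace A B D}"
  using finite_U by (auto simp: trace_def intro: finite_subset[of _ "Pow U"])

definition stars :: "'a set \<Rightarrow> 'a set set" where
  "stars T = {D. D \<subseteq> U \<and> card D < k \<and> D \<inter> T \<noteq> {}}"

lemma finite_stars: "finite (stars T)"
  using finite_U unfolding stars_def by (auto intro: finite_subset[of _ "Pow U"])

lemma card_stars:
  assumes "2 \<le> k" "finite T" shows "card (stars T) \<le> card T * star_bound"
proof -
  have one: "card (stars {v}) \<le> star_bound" for v
  proof (cases "v \<in> U")
    case True
    have kk: "k - 1 = Suc (k - 2)" using assms(1) by simp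
    obtain N where N: "card U = Suc N"
      using True finite_U by (metis card_Suc_Diff1)
    have "stars {v} = {D. D \<subseteq> U \<and> card D \<le> k - 1 \<and> D \<inter> {v} \<noteq> {}}"
      unfolding stars_def using assms(1) by auto
    then have "card (stars {v}) = binom_sum (Suc N) (Suc (k - 2)) - binom_sum N (Suc (k - 2))"
      using card_hitting_subsets[OF finite_U, of "{v}" "k - 1"] True kk N by simp
    also have "\<dots> = binom_sum N (k - 2)" by (simp add: binom_sum_Suc_Suc)
    also have "\<dots> \<le> star_bound" unfolding N by (rule binom_sum_mono) simp
    finally show ?thesis .
  next
    case False
    then have "stars {v} = {}" unfolding stars_def by blast
    then show ?thesis by simp
  qed
  have "stars T = (\<Union>v\<in>T. stars {v})" unfolding stars_def by blast
  then have "card (stars T) \<le> (\<Sum>v\<in>T. card (stars {v}))" using card_UN_le[OF assms(2)] by metis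
  also have "\<dots> \<le> card T * star_bound" using one sum_bounded_above[of T "\<lambda>v. card (stars {v})" star_bound] by simp
  finally show ?thesis .
qed

lemma CF_D: "A \<in> CF \<Longrightarrow> finite A \<and> A \<subseteq> U \<and> card A \<le> k"
  using finite_U finite_subset by (auto simp: min_covers_def)

lemma CG_D: "B \<in> CG \<Longrightarrow> finite B \<and> B \<subseteq> U \<and> card B \<le> k"
  using finite_U finite_subset by (auto simp: min_covers_def)

lemma ex_CF: "\<exists>A. A \<in> CF"
  using F_nonempty ex_cover_subset by blast

text \<open>The common end of all cases below: at most three stars, and a remainder within what is left of
  the budget \<open>376 = 3 * 96 + 72 + 16\<close>. The budget has to stay below \<open>3.95 * 96\<close>, the guaranteed
  size of the four stars of the extremal families.\<close>

lemma bound_from_cover: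
  assumes "2 \<le> k" "\<And>D A B. trace A B D \<Longrightarrow> card D < k \<Longrightarrow> D \<in> \<X> \<union> stars T"
    "finite \<X>" "finite T" "96 * card \<X> \<le> M * star_bound" "card T \<le> t" "M + 96 * t \<le> 376"
  shows "96 * card (cross_inters \<F> \<G>) \<le> 376 * star_bound"
proof -
  have "cross_inters \<F> \<G> \<subseteq> \<X> \<union> stars T"
    using assms(2) cross_inters_trace by blast
  then have "card (cross_inters \<F> \<G>) \<le> card (\<X> \<union> stars T)"
    using assms(3) finite_stars by (intro card_mono) auto
  also have "\<dots> \<le> card \<X> + card (stars T)" by (rule card_Un_le)
  also have "card (stars T) \<le> t * star_bound"
    using card_stars[OF assms(1,4)] assms(6) le_trans mult_le_mono1 by blast
  finally have "96 * card (cross_inters \<F> \<G>) \<le> 96 * card \<X> + 96 * (t * star_bound)" by simp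
  also have "\<dots> \<le> (M + 96 * t) * star_bound" using assms(5) by (simp add: algebra_simps)
  also have "\<dots> \<le> 376 * star_bound" using assms(7) by (rule mult_le_mono1)
  finally show ?thesis .
qed

text \<open>Think of \<open>L\<close> as the least size up to which the covers of one side have no common point, where
  \<open>L > k\<close> stands for the case that there is no such size.

  Covers \<open>A\<close> of size at least \<open>L\<close> have at most \<open>L\<^sup>2\<close> seeds and contribute little. The smaller ones
  contain \<open>y\<close>, so it remains to count the \<open>D\<close> that avoid \<open>y\<close>; then \<open>B\<close> avoids \<open>y\<close>, too. Let
  \<open>B0\<close> be a smallest cover on the second side that avoids \<open>y\<close>. Since \<open>A\<close> contains \<open>y\<close> and
  meets \<open>B0\<close>, there are only \<open>card B0\<close> seeds for \<open>A\<close>, which is few if \<open>card B0 \<le> card A\<close>. If \<open>B0\<close> has at most two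
  elements, the only covers escaping this are pairs, and they force \<open>D\<close> into the stars of the
  points of \<open>B0\<close>. Otherwise it remains to treat covers \<open>A\<close> that are smaller than \<open>B0\<close>. Either
  these share a second point \<open>z\<close>, which gives one more star and a single seed; or they do not,
  and then \<open>B\<close>, which is larger than they are and meets each of them outside \<open>y\<close>, has at most
  \<open>(card B0)\<^sup>2\<close> seeds.\<close>

lemma bound_no_small_spread:
  assumes k: "2 \<le> k" and L: "3 \<le> L"
    and spread: "L \<le> k \<Longrightarrow> \<forall>v. \<exists>B\<in>CG. card B \<le> L \<and> v \<notin> B"
    and y: "\<And>A. A \<in> CF \<Longrightarrow> card A < L \<Longrightarrow> y \<in> A"
  shows "96 * card (cross_inters \<F> \<G>) \<le> 376 * star_bound"
proof -
  define N1 where "N1 = {D. \<exists>A\<in>{A\<in>CF. L \<le> card A}. \<exists>B. trace A B D}"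
  have fN1: "finite N1" unfolding N1_def by (rule finite_traces)
  have N1I: "D \<in> N1" if "trace A B D" "L \<le> card A" for A B D
    using that unfolding N1_def trace_def by blast
  have N1: "96 * card N1 \<le> 72 * star_bound"
  proof (cases "L \<le> k")
    case True
    obtain \<S> where \<S>: "finite \<S>" "card \<S> \<le> L * L" "\<And>S. S \<in> \<S> \<Longrightarrow> finite S \<and> card S = 2"
      "\<And>A. A \<in> {A\<in>CF. L \<le> card A} \<Longrightarrow> \<exists>S\<in>\<S>. S \<subseteq> A"
    proof (rule two_element_seeds[of "{B\<in>CG. card B \<le> L}" L "{A\<in>CF. L \<le> card A}"])
      show "\<exists>H\<in>{B \<in> CG. card B \<le> L}. v \<notin> H" for v using spread[OF True] by blast
      show "finite H \<and> card H \<le> L" if "H \<in> {B \<in> CG. card B \<le> L}" for H using that CG_D by blast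
      show "A \<inter> H \<noteq> {}" if "A \<in> {A \<in> CF. L \<le> card A}" "H \<in> {B \<in> CG. card B \<le> L}" for A H
        using that covers_meet by blast
    qed blast
    show ?thesis unfolding N1_def
    proof (rule card_traces_near[OF _ \<S>, of "{A\<in>CF. L \<le> card A}" L])
      show "L * L * 2 ^ a \<le> 72 * 4 ^ (a - 3)" if "3 \<le> a" "L \<le> a" for a
      proof -
        have "L * L * 2 ^ a \<le> a * a * 2 ^ a" using that by (intro mult_right_mono mult_mono) auto
        then show ?thesis using square_le_power[OF that(1)] by linarith
      qed
    qed (use L in auto)
  next
    case False
    then have "N1 = {}" unfolding N1_def using CF_D by fastforce
    then show ?thesis by simp
  qed
  show ?thesis
  proof (cases "\<forall>B\<in>CG. y \<in> B")
    case True
    show ?thesis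
    proof (rule bound_from_cover[OF k _ fN1 _ N1, of "{y}" 1])
      fix D A B assume D: "trace A B D" "card D < k"
      show "D \<in> N1 \<union> stars {y}"
      proof (cases "L \<le> card A")
        case False
        then have "y \<in> A \<inter> B" using D y True unfolding trace_def by auto
        then show ?thesis using D unfolding trace_def stars_def by blast
      qed (use N1I D in blast)
    qed auto
  next
    case False
    then obtain B0 where B0: "B0 \<in> CG" "y \<notin> B0"
      and least: "\<And>B. B \<in> CG \<Longrightarrow> y \<notin> B \<Longrightarrow> card B0 \<le> card B"
      using ex_has_least_nat[of "\<lambda>B. B \<in> CG \<and> y \<notin> B" _ card] by blast
    have fB0: "finite B0" using CG_D B0 by blast
    have cross: "y \<in> A \<Longrightarrow> D \<inter> {y} = {} \<Longrightarrow> trace A B D \<Longrightarrow> y \<notin> B" for A B D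
      unfolding trace_def by blast
    let ?A2 = "{A\<in>CF. y \<in> A \<and> 2 < card A \<and> card B0 \<le> card A}"
    obtain \<S> where \<S>: "finite \<S>" "card \<S> \<le> card B0" "\<And>S. S \<in> \<S> \<Longrightarrow> finite S \<and> card S = 2"
      "\<And>A. A \<in> ?A2 \<Longrightarrow> \<exists>S\<in>\<S>. S \<subseteq> A"
    proof (rule two_element_seeds_through[of B0 "card B0" y ?A2])
      show "y \<in> A \<and> A \<inter> B0 \<noteq> {}" if "A \<in> ?A2" for A
        using that covers_meet[OF _ B0(1), of A] by blast
    qed (use fB0 B0 in auto)
    define N2 where "N2 = {D. \<exists>A\<in>?A2. \<exists>B. trace A B D}"
    have fN2: "finite N2" unfolding N2_def by (rule finite_traces)
    have N2I: "D \<in> N2" if "trace A B D" "y \<in> A" "2 < card A" "card B0 \<le> card A" for A B D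
      using that unfolding N2_def trace_def by blast
    show ?thesis
    proof (cases "card B0 \<le> 2")
      case small: True
      have N2: "96 * card N2 \<le> 16 * star_bound" unfolding N2_def
      proof (rule card_traces_near[OF _ \<S>, of ?A2 "card B0"])
        show "card B0 * 2 ^ a \<le> 16 * 4 ^ (a - 3)" if "3 \<le> a" for a
        proof -
          have "card B0 * 2 ^ a \<le> 2 * 2 ^ a" using small by (rule mult_le_mono1)
          then show ?thesis using const_le_power[OF that, of 2] by linarith
        qed
      qed auto
      show ?thesis
      proof (rule bound_from_cover[OF k _ _ _ card_Un_scaled[OF N1 N2], of "insert y B0" 3])
        fix D A B assume D: "trace A B D" "card D < k"
        show "D \<in> (N1 \<union> N2) \<union> stars (insert y B0)"
        proof (cases "L \<le> card A \<or> y \<in> D")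
          case True
          then show ?thesis using N1I D unfolding stars_def trace_def by blast
        next
          case False
          then have yA: "y \<in> A" using D y unfolding trace_def by auto
          show ?thesis
          proof (cases "2 < card A")
            case True
            then show ?thesis using N2I[OF D(1) yA] small by simp
          next
            case card2: False
            have A: "A \<in> CF" "D \<inter> A \<noteq> {}" "D \<subseteq> U" using D unfolding trace_def by auto
            obtain w where w: "w \<in> A" "w \<in> B0" using covers_meet[OF A(1) B0(1)] by blast
            have "{y, w} \<subseteq> A" "card {y, w} = 2" using w yA B0(2) by (auto simp: card_insert_if)
            then have "{y, w} = A" using CF_D[OF A(1)] card2 by (intro card_seteq) auto
            then have "w \<in> D" using A(2) False by auto
            then show ?thesis using w A(3) D(2) unfolding stars_def by auto
          qed
        qed
      next
        show "card (insert y B0) \<le> 3" using small fB0 by (simp add: card_insert_if)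
      qed (use fN1 fN2 fB0 in auto)
    next
      case big: False
      have N2: "96 * card N2 \<le> 24 * star_bound" unfolding N2_def
      proof (rule card_traces_near[OF _ \<S>, of ?A2 "card B0"])
        show "card B0 * 2 ^ a \<le> 24 * 4 ^ (a - 3)" if "3 \<le> a" "card B0 \<le> a" for a
        proof -
          have "card B0 * 2 ^ a \<le> a * 2 ^ a" using that(2) by (rule mult_le_mono1)
          moreover have "a * 2 ^ a \<le> 24 * 4 ^ (a - 3)"
            using linear_le_power[of 2 a] that(1) by simp
          ultimately show ?thesis by (rule le_trans)
        qed
      qed auto
      show ?thesis
      proof (cases "\<exists>z. z \<noteq> y \<and> (\<forall>A\<in>CF. card A < card B0 \<longrightarrow> z \<in> A)")
        case True
        then obtain z where z: "z \<noteq> y" "\<And>A. A \<in> CF \<Longrightarrow> card A < card B0 \<Longrightarrow> z \<in> A" by blast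
        let ?A3 = "{A\<in>CF. y \<in> A \<and> z \<in> A \<and> 2 < card A}"
        define N3 where "N3 = {D. \<exists>A\<in>?A3. \<exists>B. trace A B D}"
        have fN3: "finite N3" unfolding N3_def by (rule finite_traces)
        have N3: "96 * card N3 \<le> 8 * star_bound" unfolding N3_def
        proof (rule card_traces_near[of ?A3 0 "{{y, z}}" 1])
          show "1 * 2 ^ a \<le> 8 * (4::nat) ^ (a - 3)" if "3 \<le> a" for a
            using const_le_power[OF that, of 1] by simp
        qed (use z(1) in \<open>auto simp: card_insert_if\<close>)
        show ?thesis
        proof (rule bound_from_cover[OF k _ _ _ card_Un_scaled[OF card_Un_scaled[OF N1 N2] N3], of "{y, z}" 2])
          fix D A B assume D: "trace A B D" "card D < k"
          show "D \<in> ((N1 \<union> N2) \<union> N3) \<union> stars {y, z}"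
          proof (cases "L \<le> card A \<or> y \<in> D \<or> z \<in> D")
            case True
            then show ?thesis using N1I D unfolding stars_def trace_def by blast
          next
            case False
            then have yA: "y \<in> A" using D y unfolding trace_def by auto
            show ?thesis
            proof (cases "card B0 \<le> card A")
              case True
              then show ?thesis using N2I[OF D(1) yA] big by simp
            next
              case smallA: False
              have A: "A \<in> CF" "D \<inter> A \<noteq> {}" using D unfolding trace_def by auto
              have zA: "z \<in> A" using z(2)[OF A(1)] smallA by simp
              obtain w where w: "w \<in> D" "w \<in> A" using A(2) by blast
              have "{y, z, w} \<subseteq> A" "card {y, z, w} = 3"
                using w yA zA z(1) False by (auto simp: card_insert_if)
              then have "2 < card A" using CF_D[OF A(1)] card_mono[of A "{y, z, w}"] by simp
              then show ?thesis using D A(1) yA zA unfolding N3_def by blast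
            qed
          qed
        next
          show "card {y, z} \<le> 2" by (simp add: card_insert_if)
        qed (use fN1 fN2 fN3 in auto)
      next
        case no_common: False
        let ?B3 = "{B\<in>CG. y \<notin> B \<and> 2 < card B \<and> card B0 \<le> card B}"
        let ?H = "(\<lambda>A. A - {y}) ` {A\<in>CF. card A < card B0}"
        define N3 where "N3 = {D. \<exists>B\<in>?B3. \<exists>A. trace A B D}"
        have fN3: "finite N3" unfolding N3_def by (rule finite_traces)
        obtain w where w: "w \<noteq> y"
          using big by (metis B0(2) card.empty ex_in_conv le0)
        have spreadH: "\<exists>H\<in>?H. v \<notin> H" for v
        proof -
          \<comment> \<open>The point \<open>y\<close> is removed from all sets, so any other point can take its place.\<close>
          define v' where "v' = (if v = y then w else v)"
          have "v' \<noteq> y" using w by (auto simp: v'_def)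
          then obtain A where A: "A \<in> CF" "card A < card B0" "v' \<notin> A" using no_common by blast
          then have "A - {y} \<in> ?H" "v \<notin> A - {y}" by (auto simp: v'_def split: if_splits)
          then show ?thesis by blast
        qed
        obtain \<T> where \<T>: "finite \<T>" "card \<T> \<le> card B0 * card B0"
          "\<And>S. S \<in> \<T> \<Longrightarrow> finite S \<and> card S = 2" "\<And>B. B \<in> ?B3 \<Longrightarrow> \<exists>S\<in>\<T>. S \<subseteq> B"
        proof (rule two_element_seeds[OF spreadH, of "card B0" ?B3])
          show "finite H \<and> card H \<le> card B0" if H: "H \<in> ?H" for H
          proof -
            obtain A where A: "A \<in> CF" "card A < card B0" "H = A - {y}" using H by blast
            then show ?thesis using CF_D[OF A(1)] card_Diff1_le[of A y] by simp
          qed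
          show "B \<inter> H \<noteq> {}" if B: "B \<in> ?B3" and H: "H \<in> ?H" for B H
          proof -
            obtain A where A: "A \<in> CF" "H = A - {y}" using H by blast
            then show ?thesis using covers_meet[OF A(1), of B] B by blast
          qed
        qed blast
        have N3: "96 * card N3 \<le> 72 * star_bound" unfolding N3_def
        proof (rule card_traces_near'[OF _ \<T>, of ?B3 "card B0"])
          show "card B0 * card B0 * 2 ^ a \<le> 72 * 4 ^ (a - 3)" if "3 \<le> a" "card B0 \<le> a" for a
          proof -
            have "card B0 * card B0 * 2 ^ a \<le> a * a * 2 ^ a"
              using that by (intro mult_right_mono mult_mono) auto
            then show ?thesis using square_le_power[OF that(1)] by linarith
          qed
        qed auto
        show ?thesis
        proof (rule bound_from_cover[OF k _ _ _ card_Un_scaled[OF card_Un_scaled[OF N1 N2] N3], of "{y}" 1])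
          fix D A B assume D: "trace A B D" "card D < k"
          show "D \<in> ((N1 \<union> N2) \<union> N3) \<union> stars {y}"
          proof (cases "L \<le> card A \<or> y \<in> D")
            case True
            then show ?thesis using N1I D unfolding stars_def trace_def by blast
          next
            case False
            have AB: "A \<in> CF" "B \<in> CG" using D unfolding trace_def by auto
            then have "y \<in> A" using False y by auto
            then have "y \<notin> B" using cross[OF _ _ D(1)] False by blast
            moreover then have "card B0 \<le> card B" using least AB(2) by blast
            ultimately show ?thesis using D AB(2) big unfolding N3_def by auto
          qed
        qed (use fN1 fN2 fN3 in auto)
      qed
    qed
  qed
qed

end

context saturated_pair
begin

text \<open>Now the covers on the second side of size at most two have no common point. Then every cover \<open>A\<close>
  with at least three elements is found from at most four seeds, and \<open>A\<close> is never a singleton.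
  It remains to count the \<open>D\<close> for which \<open>A\<close> is an edge. If the edges form a triangle, the stars
  of its three vertices suffice. If the edges share a vertex \<open>x\<close>, then \<open>D\<close> contains \<open>x\<close>, or
  else \<open>B\<close> contains the set \<open>R\<close> of all their other ends and \<open>D\<close> one of these: up to two
  ends give one star each, and more of them restrict \<open>B\<close> so much that few \<open>D\<close> remain.\<close>

lemma bound_small_spread:
  assumes k: "2 \<le> k" and spread: "\<And>v. \<exists>B\<in>CG. card B \<le> 2 \<and> v \<notin> B"
    and no_disjoint: "\<And>e f. e \<in> CF \<Longrightarrow> f \<in> CF \<Longrightarrow> card e = 2 \<Longrightarrow> card f = 2 \<Longrightarrow> e \<inter> f \<noteq> {}"
  shows "96 * card (cross_inters \<F> \<G>) \<le> 376 * star_bound"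
proof -
  have card_ge: "2 \<le> card A" if A: "A \<in> CF" for A
  proof (rule ccontr)
    assume "\<not> 2 \<le> card A"
    then have "card A = 0 \<or> card A = 1" by linarith
    then obtain v where "A \<subseteq> {v}" using CF_D[OF A] by (auto simp: card_1_singleton_iff)
    moreover obtain B where "B \<in> CG" "v \<notin> B" using spread by blast
    ultimately show False using covers_meet[OF A, of B] by blast
  qed
  let ?A1 = "{A\<in>CF. 2 < card A}"
  define N1 where "N1 = {D. \<exists>A\<in>?A1. \<exists>B. trace A B D}"
  have fN1: "finite N1" unfolding N1_def by (rule finite_traces)
  have N1: "96 * card N1 \<le> 32 * star_bound"
  proof -
    obtain \<S> where \<S>: "finite \<S>" "card \<S> \<le> 2 * 2" "\<And>S. S \<in> \<S> \<Longrightarrow> finite S \<and> card S = 2"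
      "\<And>A. A \<in> ?A1 \<Longrightarrow> \<exists>S\<in>\<S>. S \<subseteq> A"
    proof (rule two_element_seeds[of "{B\<in>CG. card B \<le> 2}" 2 ?A1])
      show "\<exists>H\<in>{B \<in> CG. card B \<le> 2}. v \<notin> H" for v using spread by blast
      show "finite H \<and> card H \<le> 2" if "H \<in> {B \<in> CG. card B \<le> 2}" for H using that CG_D by blast
      show "A \<inter> H \<noteq> {}" if "A \<in> ?A1" "H \<in> {B \<in> CG. card B \<le> 2}" for A H
        using that covers_meet by blast
    qed blast
    show ?thesis unfolding N1_def
    proof (rule card_traces_near[OF _ \<S>, of ?A1 0])
      show "2 * 2 * 2 ^ a \<le> 32 * (4::nat) ^ (a - 3)" if "3 \<le> a" for a
        using const_le_power[OF that, of 4] by simp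
    qed auto
  qed
  have N1I: "D \<in> N1 \<or> card A = 2" if "trace A B D" for A B D
  proof (cases "card A = 2")
    case False
    have "A \<in> CF" using that unfolding trace_def by blast
    then have "A \<in> ?A1" using card_ge[of A] False by auto
    then show ?thesis using that unfolding N1_def by blast
  qed simp
  show ?thesis
  proof (cases "\<exists>x. \<forall>A\<in>CF. card A = 2 \<longrightarrow> x \<in> A")
    case True
    then obtain x where x: "\<And>A. A \<in> CF \<Longrightarrow> card A = 2 \<Longrightarrow> x \<in> A" by blast
    let ?R = "{v. v \<noteq> x \<and> {x, v} \<in> CF}"
    have "?R \<subseteq> U" using CF_D by blast
    then have fR: "finite ?R" using finite_U finite_subset by blast
    have step: "D \<in> N1 \<or> x \<in> D \<or> (\<exists>v\<in>?R. v \<in> D) \<and> B \<in> CG \<and> ?R \<subseteq> B" if D: "trace A B D" for A B D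
    proof (cases "D \<in> N1 \<or> x \<in> D")
      case False
      have AB: "A \<in> CF" "B \<in> CG" "D \<inter> A \<noteq> {}" "A \<inter> B \<subseteq> D" using D unfolding trace_def by auto
      have c: "card A = 2" using N1I[OF D] False by blast
      then have "x \<in> A" using x AB by blast
      then have xB: "x \<notin> B" using AB(4) False by blast
      obtain v where v: "A = {x, v}" "v \<noteq> x" using \<open>x \<in> A\<close> c card_2_iff[of A] by auto
      then have "v \<in> ?R" "v \<in> D" using AB False by auto
      moreover have "?R \<subseteq> B"
      proof
        fix r assume "r \<in> ?R"
        then have "{x, r} \<inter> B \<noteq> {}" using covers_meet AB(2) by blast
        then show "r \<in> B" using xB by blast
      qed
      ultimately show ?thesis using AB(2) by blast
    qed blast
    show ?thesis
    proof (cases "card ?R \<le> 2")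
      case True
      show ?thesis
      proof (rule bound_from_cover[OF k _ fN1 _ N1, of "insert x ?R" 3])
        fix D A B assume D: "trace A B D" "card D < k"
        have "D \<subseteq> U" using D unfolding trace_def by blast
        then show "D \<in> N1 \<union> stars (insert x ?R)"
          using step[OF D(1)] D(2) unfolding stars_def by blast
      next
        show "card (insert x ?R) \<le> 3" using True fR by (simp add: card_insert_if)
      qed (use fR in auto)
    next
      case False
      let ?B2 = "{B\<in>CG. ?R \<subseteq> B}"
      define N2 where "N2 = {D. \<exists>B\<in>?B2. \<exists>A. trace A B D}"
      have fN2: "finite N2" unfolding N2_def by (rule finite_traces)
      have "2 \<le> card ?R" using False by linarith
      then obtain P where P: "P \<subseteq> ?R" "card P = 2" "finite P"
        by (rule obtain_subset_with_card_n)
      have N2: "96 * card N2 \<le> 8 * star_bound" unfolding N2_def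
      proof (rule card_traces_near'[of ?B2 0 "{P}" 1])
        fix B assume B: "B \<in> ?B2"
        then have "card ?R \<le> card B" using CG_D by (intro card_mono) auto
        then show "B \<in> CG \<and> 2 < card B \<and> 0 \<le> card B" using B False by simp
      next
        show "1 * 2 ^ a \<le> 8 * (4::nat) ^ (a - 3)" if "3 \<le> a" for a
          using const_le_power[OF that, of 1] by simp
      qed (use P in auto)
      show ?thesis
      proof (rule bound_from_cover[OF k _ _ _ card_Un_scaled[OF N1 N2], of "{x}" 1])
        fix D A B assume D: "trace A B D" "card D < k"
        have "D \<subseteq> U" using D unfolding trace_def by blast
        then show "D \<in> (N1 \<union> N2) \<union> stars {x}"
          using step[OF D(1)] D unfolding stars_def N2_def by blast
      qed (use fN1 fN2 in auto)
    qed
  next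
    case False
    obtain T where T: "finite T" "card T \<le> 3" "\<And>e. e \<in> {A\<in>CF. card A = 2} \<Longrightarrow> e \<subseteq> T"
    proof (rule intersecting_pairs_triangle[of "{A\<in>CF. card A = 2}"])
      show "\<exists>e\<in>{A \<in> CF. card A = 2}. x \<notin> e" for x using False by blast
      show "e \<inter> f \<noteq> {}" if "e \<in> {A \<in> CF. card A = 2}" "f \<in> {A \<in> CF. card A = 2}" for e f
        using that no_disjoint by blast
    qed auto
    show ?thesis
    proof (rule bound_from_cover[OF k _ fN1 T(1) N1 T(2)])
      fix D A B assume D: "trace A B D" "card D < k"
      have A: "A \<in> CF" "D \<inter> A \<noteq> {}" "D \<subseteq> U" using D(1) unfolding trace_def by auto
      show "D \<in> N1 \<union> stars T"
      proof (cases "D \<in> N1")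
        case False
        then have "A \<subseteq> T" using N1I[OF D(1)] A(1) T(3) by blast
        then show ?thesis using A D(2) unfolding stars_def by blast
      qed blast
    qed simp
  qed
qed

text \<open>Covers with at most two elements consist of one point from each of the two disjoint edges. As
  they have no common point, two of them are complementary.\<close>

lemma disjoint_pairs_split:
  assumes spread: "\<And>v. \<exists>B\<in>CG. card B \<le> 2 \<and> v \<notin> B"
    and "e \<in> CF" "f \<in> CF" "card e = 2" "card f = 2" "e \<inter> f = {}"
  obtains a b c d where "distinct [a, b, c, d]" "{a, b} \<in> CF" "{c, d} \<in> CF"
    "{a, c} \<in> CG" "{b, d} \<in> CG"
proof -
  obtain a b where ab: "e = {a, b}" "a \<noteq> b" using assms(4) card_2_iff by metis
  obtain c d where cd: "f = {c, d}" "c \<noteq> d" using assms(5) card_2_iff by metis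
  have dist: "distinct [a, b, c, d]" using ab cd assms(6) by auto
  have small: "B \<in> {{a, c}, {a, d}, {b, c}, {b, d}}" if B: "B \<in> CG" "card B \<le> 2" for B
  proof -
    obtain u where u: "u \<in> {a, b}" "u \<in> B" using covers_meet[OF assms(2) B(1)] ab by blast
    obtain w where w: "w \<in> {c, d}" "w \<in> B" using covers_meet[OF assms(3) B(1)] cd by blast
    have "u \<noteq> w" using u w dist by auto
    then have "{u, w} = B" using CG_D[OF B(1)] B(2) u w by (intro card_seteq) auto
    then show ?thesis using u w by auto
  qed
  have avoid: "\<exists>B\<in>CG. B \<in> {{a, c}, {a, d}, {b, c}, {b, d}} \<and> v \<notin> B" for v
    using spread[of v] small by blast
  have "{b, c} \<in> CG \<or> {b, d} \<in> CG" using avoid[of a] by auto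
  moreover have "{a, c} \<in> CG \<or> {a, d} \<in> CG" using avoid[of b] by auto
  moreover have "{a, d} \<in> CG \<or> {b, d} \<in> CG" using avoid[of c] by auto
  moreover have "{a, c} \<in> CG \<or> {b, c} \<in> CG" using avoid[of d] by auto
  ultimately consider "{a, c} \<in> CG" "{b, d} \<in> CG" | "{a, d} \<in> CG" "{b, c} \<in> CG" by blast
  then show ?thesis
  proof cases
    case 1
    then show ?thesis using that[of a b c d] dist assms ab cd by simp
  next
    case 2
    have "{d, c} \<in> CF" using assms(3) cd by (simp add: insert_commute)
    then show ?thesis using that[of a b d c] 2 dist assms ab by auto
  qed
qed

lemma bound_or_disjoint_pairs_if:
  assumes k: "2 \<le> k"
    and L: "k < L \<or> (\<forall>v. \<exists>B\<in>CG. card B \<le> L \<and> v \<notin> B)"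
    and minimal: "\<And>l. l < L \<Longrightarrow> \<exists>y. \<forall>A\<in>CF. card A \<le> l \<longrightarrow> y \<in> A"
  shows "96 * card (cross_inters \<F> \<G>) \<le> 376 * star_bound \<or>
    (\<exists>a b c d. distinct [a, b, c, d] \<and> {a, b} \<in> CF \<and> {c, d} \<in> CF \<and> {a, c} \<in> CG \<and> {b, d} \<in> CG)"
proof (cases "3 \<le> L")
  case True
  obtain y where y: "\<And>A. A \<in> CF \<Longrightarrow> card A \<le> L - 1 \<Longrightarrow> y \<in> A"
    using minimal[of "L - 1"] True by auto
  have "96 * card (cross_inters \<F> \<G>) \<le> 376 * star_bound"
  proof (rule bound_no_small_spread[OF k True])
    show "\<forall>v. \<exists>B\<in>CG. card B \<le> L \<and> v \<notin> B" if "L \<le> k" using L that by auto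
    show "y \<in> A" if "A \<in> CF" "card A < L" for A using y[OF that(1)] that(2) by simp
  qed
  then show ?thesis by blast
next
  case False
  have spread: "\<exists>B\<in>CG. card B \<le> 2 \<and> v \<notin> B" for v
  proof -
    obtain B where "B \<in> CG" "card B \<le> L" "v \<notin> B" using L False k by auto
    then show ?thesis using False by (intro bexI[of _ B]) auto
  qed
  show ?thesis
  proof (cases "\<exists>e f. e \<in> CF \<and> f \<in> CF \<and> card e = 2 \<and> card f = 2 \<and> e \<inter> f = {}")
    case True
    then obtain e f where ef: "e \<in> CF" "f \<in> CF" "card e = 2" "card f = 2" "e \<inter> f = {}" by blast
    show ?thesis by (rule disjoint_pairs_split[OF spread ef]) blast
  next
    case False
    then show ?thesis using bound_small_spread[OF k spread] by blast
  qed
qed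

text \<open>By symmetry, the least size up to which one side has covers without a common point may be
  assumed to belong to the covers of \<open>\<F>\<close>. The conclusion is symmetric: exchanging the two
  families exchanges \<open>b\<close> and \<open>c\<close>.\<close>

lemma bound_or_disjoint_pairs:
  assumes k: "2 \<le> k"
  shows "96 * card (cross_inters \<F> \<G>) \<le> 376 * star_bound \<or>
    (\<exists>a b c d. distinct [a, b, c, d] \<and> {a, b} \<in> CF \<and> {c, d} \<in> CF \<and> {a, c} \<in> CG \<and> {b, d} \<in> CG)"
proof -
  let ?spreadF = "\<lambda>l. \<forall>v. \<exists>A\<in>CF. card A \<le> l \<and> v \<notin> A"
  let ?spreadG = "\<lambda>l. \<forall>v. \<exists>B\<in>CG. card B \<le> l \<and> v \<notin> B"
  \<comment> \<open>The alternative \<open>k < l\<close> guarantees that the least such size exists.\<close>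
  let ?Q = "\<lambda>l. k < l \<or> ?spreadF l \<or> ?spreadG l"
  define L where "L = (LEAST l. ?Q l)"
  have L: "?Q L" unfolding L_def by (rule LeastI[of ?Q "Suc k"]) simp
  have minimal: "\<not> ?Q l" if "l < L" for l
    using that unfolding L_def by (rule not_less_Least)
  consider (G) "k < L \<or> ?spreadG L" | (F) "?spreadF L" using L by blast
  then show ?thesis
  proof cases
    case G
    show ?thesis
    proof (rule bound_or_disjoint_pairs_if[OF k G])
      show "\<exists>y. \<forall>A\<in>CF. card A \<le> l \<longrightarrow> y \<in> A" if "l < L" for l using minimal[OF that] by blast
    qed
  next
    case F
    have "96 * card (cross_inters \<G> \<F>) \<le> 376 * star_bound \<or>
      (\<exists>a b c d. distinct [a, b, c, d] \<and> {a, b} \<in> CG \<and> {c, d} \<in> CG \<and> {a, c} \<in> CF \<and> {b, d} \<in> CF)"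
    proof (rule saturated_pair.bound_or_disjoint_pairs_if[OF swapped k])
      show "k < L \<or> ?spreadF L" using F by blast
      show "\<exists>y. \<forall>B\<in>CG. card B \<le> l \<longrightarrow> y \<in> B" if "l < L" for l using minimal[OF that] by blast
    qed
    moreover have "cross_inters \<G> \<F> = cross_inters \<F> \<G>"
      unfolding cross_inters_def by (auto simp: Int_commute)
    moreover have "distinct [a, b, c, d] = distinct [a, c, b, d]" for a b c d :: 'a by auto
    ultimately show ?thesis by metis
  qed
qed

end

section \<open>All intersections of a cross-intersecting pair\<close>

text \<open>Equal members \<open>F = G\<close> are admitted here, since sets that differ on four points may agree once
  these points are removed.\<close>

definition wedge :: "'a set set \<Rightarrow> 'a set set \<Rightarrow> 'a set set" where
  "wedge \<F> \<G> = {F \<inter> G | F G. F \<in> \<F> \<and> G \<in> \<G>}"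

context saturated_pair
begin

text \<open>The leading term is now the number of sets of size at most \<open>k - 1\<close>, so it suffices to
  restrict one element of each cover. This is what \<open>B0\<close> does: every \<open>A\<close> meets it and is at least
  as large. The estimate can fail only if \<open>A0\<close> and \<open>B0\<close> are the same singleton, and then all
  members of both families contain its point.\<close>

lemma wedge_bound_if:
  assumes "A0 \<in> CF" "B0 \<in> CG" "\<And>A. A \<in> CF \<Longrightarrow> card A0 \<le> card A" "card B0 \<le> card A0"
  shows "(\<exists>v\<in>U. \<forall>D\<in>wedge \<F> \<G>. v \<in> D)
    \<or> 12 * card (wedge \<F> \<G>) \<le> binom_sum (card U) (k - 1)"
proof (cases "2 \<le> card A0")
  case True
  have "96 * card (wedge \<F> \<G>) \<le> 8 * binom_sum (card U) (k - 1)"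
  proof (rule card_sets_near_min_covers[OF finite_U card_U G_sub, of CF 1 "card B0" "(\<lambda>v. {v}) ` B0" "card B0"])
    have fB0: "finite B0" using CG_D assms(2) by blast
    show "finite ((\<lambda>v. {v}) ` B0)" "card ((\<lambda>v. {v}) ` B0) \<le> card B0"
      using fB0 by (auto intro: card_image_le)
    show "1 < card A \<and> card B0 \<le> card A" if "A \<in> CF" for A
      using assms(3)[OF that] assms(4) True by linarith
    show "\<exists>S\<in>(\<lambda>v. {v}) ` B0. S \<subseteq> A" if "A \<in> CF" for A
      using covers_meet[OF that assms(2)] by blast
    show "card B0 * 2 ^ a \<le> 8 * 4 ^ (a - Suc 1)" if "1 < a" "card B0 \<le> a" for a
    proof -
      have "card B0 * 2 ^ a \<le> a * 2 ^ a" using that(2) by (rule mult_le_mono1)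
      moreover have "a * 2 ^ a \<le> 8 * 4 ^ (a - Suc 1)"
        using linear_le_power[of 1 a] that(1) by simp
      ultimately show ?thesis by (rule le_trans)
    qed
    show "D \<subseteq> U \<and> (\<exists>A\<in>CF. card (D \<union> A) \<le> k)" if D: "D \<in> wedge \<F> \<G>" for D
    proof -
      obtain A B where "trace A B D" using D ex_trace unfolding wedge_def by blast
      then show ?thesis unfolding trace_def by blast
    qed
  qed auto
  then show ?thesis by linarith
next
  case False
  obtain v where v: "v \<in> A0" "v \<in> B0" using covers_meet[OF assms(1,2)] by blast
  have fin: "finite A0" "finite B0" "A0 \<subseteq> U" using CF_D CG_D assms by blast+
  have "A0 = {v}" "B0 = {v}"
    using v fin False assms(4) card_seteq[of A0 "{v}"] card_seteq[of B0 "{v}"] by auto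
  then have "v \<in> F \<inter> G" if "F \<in> \<F>" "G \<in> \<G>" for F G
    using that assms(1,2) unfolding min_covers_def by auto
  then have "\<forall>D\<in>wedge \<F> \<G>. v \<in> D" unfolding wedge_def by blast
  then show ?thesis using v fin by blast
qed

lemma wedge_bound:
  "(\<exists>v\<in>U. \<forall>D\<in>wedge \<F> \<G>. v \<in> D) \<or> 12 * card (wedge \<F> \<G>) \<le> binom_sum (card U) (k - 1)"
proof -
  obtain A0 where A0: "A0 \<in> CF" "\<And>A. A \<in> CF \<Longrightarrow> card A0 \<le> card A"
    using ex_CF ex_has_least_nat[of "\<lambda>A. A \<in> CF" _ card] by blast
  obtain B0 where B0: "B0 \<in> CG" "\<And>B. B \<in> CG \<Longrightarrow> card B0 \<le> card B"
    using saturated_pair.ex_CF[OF swapped] ex_has_least_nat[of "\<lambda>B. B \<in> CG" _ card] by blast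
  have "wedge \<G> \<F> = wedge \<F> \<G>" unfolding wedge_def by (auto simp: Int_commute)
  then show ?thesis
    using wedge_bound_if[OF A0(1) B0(1) A0(2)]
      saturated_pair.wedge_bound_if[OF swapped B0(1) A0(1) B0(2)] nat_le_linear by metis
qed

end

lemma wedge_mono: "\<F> \<subseteq> \<F>' \<Longrightarrow> \<G> \<subseteq> \<G>' \<Longrightarrow> wedge \<F> \<G> \<subseteq> wedge \<F>' \<G>'"
  unfolding wedge_def by blast

lemma wedge_star_or_small:
  assumes "finite U" "100 * l\<^sup>2 \<le> card U" "U \<noteq> {}" "\<F> \<subseteq> nsets U l" "\<G> \<subseteq> nsets U l"
    and "cross_intersecting \<F> \<G>"
  shows "(\<exists>v\<in>U. \<forall>D\<in>wedge \<F> \<G>. v \<in> D)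
    \<or> 0 < l \<and> 12 * card (wedge \<F> \<G>) \<le> binom_sum (card U) (l - 1)"
proof (cases "\<F> = {} \<or> \<G> = {}")
  case True
  then have "wedge \<F> \<G> = {}" unfolding wedge_def by blast
  then show ?thesis using assms(3) by blast
next
  case False
  then obtain \<F>' \<G>' where sat: "\<F> \<subseteq> \<F>'" "\<G> \<subseteq> \<G>'" "saturated_pair U l \<F>' \<G>'"
    using ex_saturated_pair[OF assms(1,2,4,5,6)] by blast
  interpret saturated_pair U l \<F>' \<G>' by (rule sat)
  have sub: "wedge \<F> \<G> \<subseteq> wedge \<F>' \<G>'" using wedge_mono sat by blast
  have "wedge \<F>' \<G>' \<subseteq> Pow U"
  proof
    fix D assume "D \<in> wedge \<F>' \<G>'"
    then obtain F G where "F \<in> \<F>'" "D = F \<inter> G" unfolding wedge_def by blast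
    moreover then have "F \<subseteq> U" using F_sub by (auto simp: nsets_def)
    ultimately show "D \<in> Pow U" by blast
  qed
  then have "finite (wedge \<F>' \<G>')" using finite_U by (simp add: finite_subset)
  then have "card (wedge \<F> \<G>) \<le> card (wedge \<F>' \<G>')" using sub by (rule card_mono)
  then have "12 * card (wedge \<F> \<G>) \<le> 12 * card (wedge \<F>' \<G>')" by simp
  then show ?thesis using wedge_bound sub k_pos le_trans by blast
qed

text \<open>The right-hand side counts the sets that meet a fixed pair of points. It is attained by two
  stars with different centres. If one of the two pairs is not a star, it has at most
  one twelfth of the available sets, far less than a second star.\<close>

lemma two_wedges_bound:
  assumes U: "finite U" "100 * l\<^sup>2 \<le> card U" "2 \<le> card U"
    and "\<P>1 \<subseteq> nsets U l" "\<Q>1 \<subseteq> nsets U l" "cross_intersecting \<P>1 \<Q>1"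
    and "\<P>2 \<subseteq> nsets U l" "\<Q>2 \<subseteq> nsets U l" "cross_intersecting \<P>2 \<Q>2"
  shows "card (wedge \<P>1 \<Q>1 \<union> wedge \<P>2 \<Q>2)
    \<le> binom_sum (card U) l - binom_sum (card U - 2) l"
proof -
  let ?P = "\<lambda>i j. binom_sum (card U - i) j"
  let ?hit = "\<lambda>T. {D. D \<subseteq> U \<and> card D \<le> l \<and> D \<inter> T \<noteq> {}}"
  have fhit: "finite (?hit T)" for T using U(1) by (auto intro: finite_subset[of _ "Pow U"])
  have in_hit: "wedge \<P> \<Q> \<subseteq> ?hit T"
    if "\<P> \<subseteq> nsets U l" "\<forall>D\<in>wedge \<P> \<Q>. v \<in> D" "v \<in> T" for \<P> \<Q> :: "'a set set" and v T
  proof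
    fix D assume D: "D \<in> wedge \<P> \<Q>"
    then obtain F G where FG: "F \<in> \<P>" "D = F \<inter> G" unfolding wedge_def by blast
    then have F: "F \<subseteq> U" "finite F" "card F = l" using that(1) by (auto simp: nsets_def)
    then have "card D \<le> l" using FG(2) card_mono[of F D] by auto
    moreover have "v \<in> D" using that(2) D by blast
    ultimately show "D \<in> ?hit T" using F FG(2) that(3) by blast
  qed
  have U0: "U \<noteq> {}" using U(3) by auto
  consider
      (both) v w where "v \<in> U" "w \<in> U" "\<forall>D\<in>wedge \<P>1 \<Q>1. v \<in> D" "\<forall>D\<in>wedge \<P>2 \<Q>2. w \<in> D"
    | (small) W1 W2 where "0 < l" "wedge \<P>1 \<Q>1 \<union> wedge \<P>2 \<Q>2 = W1 \<union> W2"
        "12 * card W1 \<le> ?P 0 (l - 1)"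
        "(\<exists>v\<in>U. W2 \<subseteq> ?hit {v}) \<or> 12 * card W2 \<le> ?P 0 (l - 1)"
  proof -
    note w1 = wedge_star_or_small[OF U(1,2) U0 assms(4-6)]
    note w2 = wedge_star_or_small[OF U(1,2) U0 assms(7-9)]
    show ?thesis
    proof (cases "\<exists>v\<in>U. \<forall>D\<in>wedge \<P>1 \<Q>1. v \<in> D")
      case True
      then obtain v where v: "v \<in> U" "\<forall>D\<in>wedge \<P>1 \<Q>1. v \<in> D" by blast
      show ?thesis
      proof (cases "\<exists>v\<in>U. \<forall>D\<in>wedge \<P>2 \<Q>2. v \<in> D")
        case True
        then show ?thesis using both v by blast
      next
        case False
        have "wedge \<P>1 \<Q>1 \<subseteq> ?hit {v}" using v by (intro in_hit assms) auto
        then show ?thesis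
          using small[of "wedge \<P>2 \<Q>2" "wedge \<P>1 \<Q>1"] w2 False v(1) by (simp add: Un_commute) blast
      qed
    next
      case False
      show ?thesis
      proof (rule small[of "wedge \<P>1 \<Q>1" "wedge \<P>2 \<Q>2"])
        show "(\<exists>v\<in>U. wedge \<P>2 \<Q>2 \<subseteq> ?hit {v}) \<or> 12 * card (wedge \<P>2 \<Q>2) \<le> ?P 0 (l - 1)"
        proof (cases "\<exists>v\<in>U. \<forall>D\<in>wedge \<P>2 \<Q>2. v \<in> D")
          case True
          then obtain v where v: "v \<in> U" "\<forall>D\<in>wedge \<P>2 \<Q>2. v \<in> D" by blast
          have "wedge \<P>2 \<Q>2 \<subseteq> ?hit {v}" using v by (intro in_hit assms) auto
          then show ?thesis using v(1) by blast
        next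
          case False
          then have "12 * card (wedge \<P>2 \<Q>2) \<le> binom_sum (card U) (l - 1)" using w2 by blast
          then show ?thesis by simp
        qed
      qed (use w1 False in simp_all)
    qed
  qed
  then show ?thesis
  proof cases
    case both
    obtain T where T: "v \<in> T" "w \<in> T" "T \<subseteq> U" "card T = 2"
    proof (cases "v = w")
      case False
      then show ?thesis using that[of "{v, w}"] both by simp
    next
      case True
      have "\<not> U \<subseteq> {v}" using U(3) card_mono[of "{v}" U] by auto
      then obtain u where "u \<in> U" "u \<noteq> v" by blast
      then show ?thesis using that[of "{v, u}"] both True by simp
    qed
    have "wedge \<P>1 \<Q>1 \<union> wedge \<P>2 \<Q>2 \<subseteq> ?hit T"
      using in_hit[OF assms(4) both(3) T(1)] in_hit[OF assms(7) both(4) T(2)] by blast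
    then have "card (wedge \<P>1 \<Q>1 \<union> wedge \<P>2 \<Q>2) \<le> card (?hit T)"
      using fhit by (rule card_mono[rotated])
    then show ?thesis using card_hitting_subsets[OF U(1) T(3)] T(4) by simp
  next
    case small
    obtain j where j: "l = Suc j" using small(1) gr0_implies_Suc by blast
    obtain m where m: "card U = Suc (Suc m)" using U(3) by (metis add_2_eq_Suc le_Suc_ex)
    have W2: "card W2 \<le> binom_sum (Suc m) j \<or> 12 * card W2 \<le> ?P 0 j"
    proof (cases "\<exists>v\<in>U. W2 \<subseteq> ?hit {v}")
      case True
      then obtain v where v: "v \<in> U" "W2 \<subseteq> ?hit {v}" by blast
      have "card W2 \<le> card (?hit {v})" using v(2) fhit by (rule card_mono[rotated])
      also have "\<dots> = binom_sum (Suc (Suc m)) (Suc j) - binom_sum (Suc m) (Suc j)"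
        using card_hitting_subsets[OF U(1), of "{v}" l] v(1) j m by simp
      also have "\<dots> = binom_sum (Suc m) j" by (simp add: binom_sum_Suc_Suc)
      finally show ?thesis by blast
    qed (use small(4) j in simp)
    have c: "100 * ?P 0 j \<le> 100 * binom_sum m j + 2 * ?P 0 j"
      using binom_sum_drop[OF U(2), of j 100 2] j m by simp
    have "binom_sum m j \<le> binom_sum (Suc m) j" by (rule binom_sum_mono) simp
    moreover have "12 * card W1 \<le> ?P 0 j" using small(3) j by simp
    moreover have "card (W1 \<union> W2) \<le> card W1 + card W2" by (rule card_Un_le)
    ultimately have "card (W1 \<union> W2) \<le> binom_sum (Suc m) j + binom_sum m j"
      using W2 c by linarith
    also have "\<dots> = binom_sum (card U) l - binom_sum (card U - 2) l"
      unfolding m j by (simp add: binom_sum_Suc_Suc)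
    finally show ?thesis using small(2) by simp
  qed
qed

section \<open>The extremal pattern\<close>

definition restriction :: "'a set set \<Rightarrow> 'a set \<Rightarrow> 'a set \<Rightarrow> 'a set set" where
  "restriction \<F> V S = {F - V | F. F \<in> \<F> \<and> F \<inter> V = S}"

lemma restriction_sub_nsets:
  assumes "\<F> \<subseteq> nsets U k" "card S = s" "finite S"
  shows "restriction \<F> V S \<subseteq> nsets (U - V) (k - s)"
proof
  fix E assume "E \<in> restriction \<F> V S"
  then obtain F where F: "F \<in> \<F>" "F \<inter> V = S" "E = F - V" unfolding restriction_def by blast
  then have "F \<subseteq> U" "finite F" "card F = k" using assms(1) by (auto simp: nsets_def)
  moreover have "card (F - V) = card F - card (F \<inter> V)"
    using \<open>finite F\<close> by (simp add: card_Diff_subset_Int)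
  ultimately show "E \<in> nsets (U - V) (k - s)" using F assms(2) by (auto simp: nsets_def)
qed

lemma restriction_cross:
  assumes "cross_intersecting \<F> \<G>" "S \<inter> T = {}"
  shows "cross_intersecting (restriction \<F> V S) (restriction \<G> V T)"
  using assms unfolding cross_intersecting_def restriction_def by blast

text \<open>The covering pairs force \<open>F\<close> to contain one of \<open>{a, b}\<close>, \<open>{c, d}\<close>, \<open>{a, d}\<close>, \<open>{b, c}\<close>, but
  \<open>{a, b}\<close> and \<open>{c, d}\<close> meet \<open>G\<close>. Hence if \<open>F \<inter> G\<close> avoids the four points, then \<open>F\<close> and \<open>G\<close>
  contain \<open>{a, d}\<close> and \<open>{b, c}\<close>, in some order, and their parts outside the four points form
  again a cross-intersecting pair.\<close>

lemma disjoint_pairs_bound: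
  assumes U: "finite U" "100 * k\<^sup>2 \<le> card U" and k: "2 \<le> k"
    and \<F>: "\<F> \<subseteq> nsets U k" and \<G>: "\<G> \<subseteq> nsets U k" and cross: "cross_intersecting \<F> \<G>"
    and dist: "distinct [a, b, c, d]" and abcd: "{a, b, c, d} \<subseteq> U"
    and F: "\<And>F. F \<in> \<F> \<Longrightarrow> {a, c} \<inter> F \<noteq> {} \<and> {b, d} \<inter> F \<noteq> {}"
    and G: "\<And>G. G \<in> \<G> \<Longrightarrow> {a, b} \<inter> G \<noteq> {} \<and> {c, d} \<inter> G \<noteq> {}"
  shows "card (cross_inters \<F> \<G>)
    \<le> (binom_sum (card U) (k - 1) - binom_sum (card U - 4) (k - 1))
      + (binom_sum (card U - 4) (k - 2) - binom_sum (card U - 6) (k - 2))"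
proof -
  let ?V = "{a, b, c, d}"
  let ?hit = "{D. D \<subseteq> U \<and> card D \<le> k - 1 \<and> D \<inter> ?V \<noteq> {}}"
  let ?W = "wedge (restriction \<F> ?V {a, d}) (restriction \<G> ?V {b, c})
    \<union> wedge (restriction \<F> ?V {b, c}) (restriction \<G> ?V {a, d})"
  have V: "card ?V = 4" "finite ?V" using dist by auto
  have pair: "card {a, d} = 2" "card {b, c} = 2" "{a, d} \<inter> {b, c} = {}" using dist by auto
  have cardU: "card (U - ?V) = card U - 4" using V abcd by (metis card_Diff_subset)
  have "cross_inters \<F> \<G> \<subseteq> ?hit \<union> ?W"
  proof
    fix D assume "D \<in> cross_inters \<F> \<G>"
    then obtain A B where AB: "A \<in> \<F>" "B \<in> \<G>" "A \<noteq> B" "D = A \<inter> B"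
      unfolding cross_inters_def by blast
    have A: "A \<subseteq> U" "finite A" "card A = k" and B: "finite B" "card B = k"
      using AB \<F> \<G> by (auto simp: nsets_def)
    show "D \<in> ?hit \<union> ?W"
    proof (cases "D \<inter> ?V = {}")
      case False
      have "\<not> A \<subseteq> B" using A B AB(3) card_subset_eq[of B A] by auto
      then have "A \<inter> B \<subset> A" by blast
      then have "card D < k" using A AB(4) psubset_card_mono by blast
      then show ?thesis using False A(1) AB(4) by auto
    next
      case True
      have "A \<inter> ?V = {a, d} \<and> B \<inter> ?V = {b, c} \<or> A \<inter> ?V = {b, c} \<and> B \<inter> ?V = {a, d}"
      proof -
        have h: "a \<in> A \<or> c \<in> A" "b \<in> A \<or> d \<in> A" "a \<in> B \<or> b \<in> B" "c \<in> B \<or> d \<in> B"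
          using F[OF AB(1)] G[OF AB(2)] by auto
        have n: "\<not> (a \<in> A \<and> a \<in> B)" "\<not> (b \<in> A \<and> b \<in> B)" "\<not> (c \<in> A \<and> c \<in> B)" "\<not> (d \<in> A \<and> d \<in> B)"
          using True AB(4) by auto
        have "a \<in> A \<and> d \<in> A \<and> b \<notin> A \<and> c \<notin> A \<and> b \<in> B \<and> c \<in> B \<and> a \<notin> B \<and> d \<notin> B
            \<or> b \<in> A \<and> c \<in> A \<and> a \<notin> A \<and> d \<notin> A \<and> a \<in> B \<and> d \<in> B \<and> b \<notin> B \<and> c \<notin> B"
          using h n by blast
        then show ?thesis by auto
      qed
      moreover have "A - ?V \<in> restriction \<F> ?V (A \<inter> ?V)" "B - ?V \<in> restriction \<G> ?V (B \<inter> ?V)"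
        using AB(1,2) unfolding restriction_def by blast+
      then have "(A - ?V) \<inter> (B - ?V)
          \<in> wedge (restriction \<F> ?V (A \<inter> ?V)) (restriction \<G> ?V (B \<inter> ?V))"
        unfolding wedge_def by blast
      moreover have "(A - ?V) \<inter> (B - ?V) = D" using True AB(4) by blast
      ultimately have "D \<in> ?W" by auto
      then show ?thesis by blast
    qed
  qed
  moreover have "finite ?hit" using U(1) by (auto intro: finite_subset[of _ "Pow U"])
  moreover have W: "card ?W \<le> binom_sum (card (U - ?V)) (k - 2) - binom_sum (card (U - ?V) - 2) (k - 2)"
  proof (rule two_wedges_bound)
    obtain m where m: "k = m + 2" using k by (metis add.commute le_Suc_ex)
    have sq: "k\<^sup>2 = m\<^sup>2 + 4 * m + 4" unfolding m by (simp add: power2_eq_square algebra_simps)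
    show "100 * (k - 2)\<^sup>2 \<le> card (U - ?V)" "2 \<le> card (U - ?V)"
      using U(2) m unfolding cardU sq by auto
  qed (use U restriction_sub_nsets[OF \<F>, of _ 2] restriction_sub_nsets[OF \<G>, of _ 2]
        restriction_cross[OF cross] pair in \<open>auto simp del: card_insert_disjoint\<close>)
  moreover have "finite ?W"
  proof (rule finite_subset)
    have "F \<subseteq> U" if "F \<in> \<F>" for F using that \<F> by (auto simp: nsets_def)
    then have "restriction \<F> ?V S \<subseteq> Pow U" for S unfolding restriction_def by blast
    moreover have "wedge \<P> \<Q> \<subseteq> Pow U" if "\<P> \<subseteq> Pow U" for \<P> \<Q> :: "'a set set"
      using that unfolding wedge_def by blast
    ultimately show "?W \<subseteq> Pow U" by simp
  qed (use U in simp)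
  ultimately have "card (cross_inters \<F> \<G>) \<le> card (?hit \<union> ?W)" by (intro card_mono) auto
  also have "\<dots> \<le> card ?hit + card ?W" by (rule card_Un_le)
  also have "card ?hit = binom_sum (card U) (k - 1) - binom_sum (card U - 4) (k - 1)"
    using card_hitting_subsets[OF U(1) abcd] V(1) by simp
  finally show ?thesis using W cardU by simp
qed

section \<open>The number of intersections attained by the two families\<close>

text \<open>Prescribed parts \<open>D \<union> X\<close> and \<open>D \<union> Y\<close> can be filled up to \<open>k\<close>-sets by fresh, pairwise disjoint
  elements without enlarging their intersection \<open>D\<close>.\<close>

lemma ex_pair_with_intersection:
  assumes U: "finite U" "4 * k \<le> card U"
    and sub: "D \<subseteq> U" "X \<subseteq> U" "Y \<subseteq> U" "X \<inter> Y = {}"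
    and card: "card (D \<union> X) \<le> k" "card (D \<union> Y) \<le> k" "card D < k"
  obtains F G where "F \<in> nsets U k" "G \<in> nsets U k" "D \<union> X \<subseteq> F" "D \<union> Y \<subseteq> G"
    "F \<inter> G = D" "F \<noteq> G"
proof -
  have fin: "finite D" "finite X" "finite Y" using sub U finite_subset by blast+
  let ?W = "D \<union> X \<union> Y"
  have "?W = (D \<union> X) \<union> (D \<union> Y)" by blast
  then have cW: "card ?W \<le> 2 * k" using card_Un_le[of "D \<union> X" "D \<union> Y"] card by simp
  have "k - card (D \<union> X) \<le> card (U - ?W)"
    using cW U sub fin by (simp add: card_Diff_subset)
  then obtain Z where Z: "Z \<subseteq> U - ?W" "card Z = k - card (D \<union> X)" "finite Z"
    by (rule obtain_subset_with_card_n)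
  have "card (?W \<union> Z) \<le> 3 * k" using card_Un_le[of ?W Z] cW Z(2) by simp
  then have "k - card (D \<union> Y) \<le> card (U - (?W \<union> Z))"
    using U sub fin Z by (subst card_Diff_subset) auto
  then obtain Z' where Z': "Z' \<subseteq> U - (?W \<union> Z)" "card Z' = k - card (D \<union> Y)" "finite Z'"
    by (rule obtain_subset_with_card_n)
  let ?F = "D \<union> X \<union> Z" and ?G = "D \<union> Y \<union> Z'"
  have F: "card ?F = k" using Z fin card by (subst card_Un_disjoint) auto
  have G: "card ?G = k" using Z' fin card by (subst card_Un_disjoint) auto
  have D: "?F \<inter> ?G = D" using sub(4) Z(1) Z'(1) by blast
  have "?F \<noteq> ?G" using D F card(3) by auto
  moreover have "?F \<in> nsets U k" using F sub Z fin by (auto simp: nsets_def)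
  moreover have "?G \<in> nsets U k" using G sub Z' fin by (auto simp: nsets_def)
  ultimately show ?thesis using that[of ?F ?G] D by blast
qed

lemma mem_cross_inters_stars:
  assumes n: "100 * k\<^sup>2 \<le> n" and k: "2 \<le> k"
    and sub: "D \<subseteq> {1..n}" "X \<inter> Y = {}" "X \<subseteq> {1..6}" "Y \<subseteq> {1..6}"
    and card: "card D + card X \<le> k" "card D + card Y \<le> k" "card D < k"
    and A: "S \<subseteq> D \<union> X" "full_star n k S \<subseteq> \<A>" "T \<subseteq> D \<union> Y" "full_star n k T \<subseteq> \<B>"
  shows "D \<in> cross_inters \<A> \<B>"
proof -
  have "2 * k \<le> k\<^sup>2" using k by (simp add: power2_eq_square)
  then have n': "6 \<le> n" "4 * k \<le> card {1..n}" using n k by auto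
  then have "X \<subseteq> {1..n}" "Y \<subseteq> {1..n}" using sub by fastforce+
  moreover have "card (D \<union> X) \<le> k" "card (D \<union> Y) \<le> k"
    using card card_Un_le[of D X] card_Un_le[of D Y] by simp_all
  ultimately obtain F G where FG: "F \<in> nsets {1..n} k" "G \<in> nsets {1..n} k"
      "D \<union> X \<subseteq> F" "D \<union> Y \<subseteq> G" "F \<inter> G = D" "F \<noteq> G"
    using ex_pair_with_intersection[of "{1..n}" k D X Y] n' sub card by blast
  have "S \<subseteq> F" "T \<subseteq> G" using A(1,3) FG(3,4) by blast+
  then have "F \<in> full_star n k S" "G \<in> full_star n k T"
    using FG(1,2) unfolding full_star_def by simp_all
  then have "F \<in> \<A>" "G \<in> \<B>" using A(2,4) by blast+
  then show ?thesis using FG unfolding cross_inters_def by blast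
qed

text \<open>Every set of fewer than \<open>k\<close> elements that meets \<open>{1, 2, 3, 4}\<close> is an intersection, by adding
  one further point of \<open>{1, 2, 3, 4}\<close> on each side. A set that avoids these points but meets \<open>{5, 6}\<close> needs
  two more points on each side, \<open>{1, 4}\<close> and \<open>{2, 3}\<close>, which is why its size is at most \<open>k - 2\<close>.\<close>

lemma card_cross_inters_A1_A2_ge:
  assumes n: "100 * k\<^sup>2 \<le> n" and k: "2 \<le> k"
  shows "(binom_sum n (k - 1) - binom_sum (n - 4) (k - 1))
      + (binom_sum (n - 4) (k - 2) - binom_sum (n - 6) (k - 2))
    \<le> card (cross_inters (A1 n k) (A2 n k))"
proof -
  let ?X = "{D. D \<subseteq> {1..n} \<and> card D \<le> k - 1 \<and> D \<inter> {1, 2, 3, 4} \<noteq> {}}"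
  let ?Y = "{D. D \<subseteq> {1..n} - {1, 2, 3, 4} \<and> card D \<le> k - 2 \<and> D \<inter> {5, 6} \<noteq> {}}"
  have "2 * k \<le> k\<^sup>2" using k by (simp add: power2_eq_square)
  then have n6: "6 \<le> n" using n k by linarith
  have "?X \<subseteq> cross_inters (A1 n k) (A2 n k)"
  proof
    fix D assume D: "D \<in> ?X"
    note mem = mem_cross_inters_stars[OF n k, of D]
    have c: "D \<subseteq> {1..n}" "card D + 1 \<le> k" using D k by auto
    consider "1 \<in> D" | "2 \<in> D" | "3 \<in> D" | "4 \<in> D" using D by blast
    then show "D \<in> cross_inters (A1 n k) (A2 n k)"
    proof cases
      case 1 then show ?thesis
        by (intro mem[of "{2}" "{3}" "{1, 2}" _ "{1, 3}"]) (use c in \<open>auto simp: A1_def A2_def\<close>)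
    next
      case 2 then show ?thesis
        by (intro mem[of "{1}" "{4}" "{1, 2}" _ "{2, 4}"]) (use c in \<open>auto simp: A1_def A2_def\<close>)
    next
      case 3 then show ?thesis
        by (intro mem[of "{4}" "{1}" "{3, 4}" _ "{1, 3}"]) (use c in \<open>auto simp: A1_def A2_def\<close>)
    next
      case 4 then show ?thesis
        by (intro mem[of "{3}" "{2}" "{3, 4}" _ "{2, 4}"]) (use c in \<open>auto simp: A1_def A2_def\<close>)
    qed
  qed
  moreover have "?Y \<subseteq> cross_inters (A1 n k) (A2 n k)"
  proof
    fix D assume D: "D \<in> ?Y"
    note mem = mem_cross_inters_stars[OF n k, of D]
    have c: "D \<subseteq> {1..n}" "card D + 2 \<le> k" using D k by auto
    consider "5 \<in> D" | "6 \<in> D" using D by blast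
    then show "D \<in> cross_inters (A1 n k) (A2 n k)"
    proof cases
      case 1 then show ?thesis
        by (intro mem[of "{1, 4}" "{2, 3}" "{1, 4, 5}" _ "{2, 3, 5}"])
          (use c in \<open>auto simp: A1_def A2_def\<close>)
    next
      case 2 then show ?thesis
        by (intro mem[of "{2, 3}" "{1, 4}" "{2, 3, 6}" _ "{1, 4, 6}"])
          (use c in \<open>auto simp: A1_def A2_def\<close>)
    qed
  qed
  moreover have "finite (cross_inters (A1 n k) (A2 n k))"
  proof (rule finite_subset)
    show "cross_inters (A1 n k) (A2 n k) \<subseteq> Pow {1..n}"
      unfolding cross_inters_def A1_def full_star_def nsets_def by blast
  qed simp
  ultimately have "card (?X \<union> ?Y) \<le> card (cross_inters (A1 n k) (A2 n k))"
    by (intro card_mono) auto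
  moreover have "card (?X \<union> ?Y) = card ?X + card ?Y"
    by (intro card_Un_disjoint) (auto intro: finite_subset[of _ "Pow {1..n}"])
  moreover have "card ?X = binom_sum n (k - 1) - binom_sum (n - 4) (k - 1)"
    using card_hitting_subsets[of "{1..n}" "{1, 2, 3, 4}" "k - 1"] n6 by (simp add: numeral_eq_Suc)
  moreover have "card ?Y = binom_sum (n - 4) (k - 2) - binom_sum (n - 6) (k - 2)"
  proof -
    have "card ({1..n} - {1, 2, 3, 4}) = n - 4" using n6 by (subst card_Diff_subset) auto
    then show ?thesis
      using card_hitting_subsets[of "{1..n} - {1, 2, 3, 4}" "{5, 6}" "k - 2"] n6 by simp
  qed
  ultimately show ?thesis by simp
qed

text \<open>The sets that meet four fixed points are four stars in ground sets of sizes \<open>n - 1\<close> to \<open>n - 4\<close>.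
  Let \<open>p\<close> be the number of sets of size at most \<open>k - 2\<close>. As \<open>100 k \<ge> 200\<close>, the four stars have
  at least \<open>4 p - (1 + 2 + 3 + 4) p / 200 = 3.95 p\<close> members, whereas \<open>376 / 96 < 3.92\<close>.\<close>

lemma star_sum_ge:
  assumes n: "100 * k\<^sup>2 \<le> n" and k: "2 \<le> k"
  shows "376 * binom_sum n (k - 2) \<le> 96 * (binom_sum n (k - 1) - binom_sum (n - 4) (k - 1))"
proof -
  have "2 * k \<le> k\<^sup>2" using k by (simp add: power2_eq_square)
  then have "4 \<le> n" using n k by linarith
  then have "n = Suc (Suc (Suc (Suc (n - 4))))" by simp
  then obtain m where m: "n = Suc (Suc (Suc (Suc m)))" ..
  obtain j where j: "k = Suc (Suc j)" using k by (metis add_2_eq_Suc le_Suc_ex)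
  have drop: "200 * binom_sum n j \<le> 200 * binom_sum (n - i) j + i * binom_sum n j" for i
    using n j by (intro binom_sum_drop[of k]) auto
  have "binom_sum n (k - 1) - binom_sum (n - 4) (k - 1)
      = binom_sum (n - 1) j + binom_sum (n - 2) j + binom_sum (n - 3) j + binom_sum (n - 4) j"
    unfolding m j by (simp add: binom_sum_Suc_Suc numeral_eq_Suc)
  then show ?thesis
    using drop[of 1] drop[of 2] drop[of 3] drop[of 4] j by simp
qed

section \<open>The maximum\<close>

theorem theorem1p6:
  fixes n k :: nat and \<F> \<G> :: "nat set set"
  assumes "n > 0" and "k > 0"
    and "n \<ge> 100 * k\<^sup>2"
    and "\<F> \<subseteq> nsets {1..n} k" and "\<G> \<subseteq> nsets {1..n} k"
    and "cross_intersecting \<F> \<G>"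
  shows "card (cross_inters \<F> \<G>) \<le> card (cross_inters (A1 n k) (A2 n k))"
proof (cases "k = 1 \<or> \<F> = {} \<or> \<G> = {}")
  case True
  have "cross_inters \<F> \<G> = {}"
  proof (rule ccontr)
    assume "cross_inters \<F> \<G> \<noteq> {}"
    then obtain F G where FG: "F \<in> \<F>" "G \<in> \<G>" "F \<noteq> G" unfolding cross_inters_def by blast
    then have "card F = 1" "card G = 1" using True assms(4,5) by (auto simp: nsets_def)
    then obtain u v where "F = {u}" "G = {v}" by (metis card_1_singletonE)
    then show False using assms(6) FG unfolding cross_intersecting_def by fastforce
  qed
  then show ?thesis by simp
next
  case False
  then have k: "2 \<le> k" using assms(2) by linarith
  have large: "100 * k\<^sup>2 \<le> card {1..n}" using assms(3) by simp
  obtain \<F>' \<G>' where sat: "\<F> \<subseteq> \<F>'" "\<G> \<subseteq> \<G>'" "saturated_pair {1..n} k \<F>' \<G>'"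
    using ex_saturated_pair[OF _ large assms(4-6)] False by blast
  interpret saturated_pair "{1..n}" k \<F>' \<G>' by (rule sat)
  have "cross_inters \<F>' \<G>' \<subseteq> Pow {1..n}"
    using F_sub unfolding cross_inters_def nsets_def by blast
  then have "finite (cross_inters \<F>' \<G>')" by (simp add: finite_subset)
  moreover have "cross_inters \<F> \<G> \<subseteq> cross_inters \<F>' \<G>'"
    using sat(1,2) unfolding cross_inters_def by blast
  ultimately have le: "card (cross_inters \<F> \<G>) \<le> card (cross_inters \<F>' \<G>')" by (rule card_mono)
  have ge: "(binom_sum n (k - 1) - binom_sum (n - 4) (k - 1))
      + (binom_sum (n - 4) (k - 2) - binom_sum (n - 6) (k - 2))
    \<le> card (cross_inters (A1 n k) (A2 n k))"
    by (rule card_cross_inters_A1_A2_ge[OF assms(3) k])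
  consider "96 * card (cross_inters \<F>' \<G>') \<le> 376 * binom_sum n (k - 2)"
    | (extremal) a b c d where "distinct [a, b, c, d]" "{a, b} \<in> CF" "{c, d} \<in> CF"
        "{a, c} \<in> CG" "{b, d} \<in> CG"
    using bound_or_disjoint_pairs[OF k] by auto
  then show ?thesis
  proof cases
    case 1
    then show ?thesis using star_sum_ge[OF assms(3) k] le ge by linarith
  next
    case extremal
    have "card (cross_inters \<F>' \<G>')
      \<le> (binom_sum (card {1..n}) (k - 1) - binom_sum (card {1..n} - 4) (k - 1))
        + (binom_sum (card {1..n} - 4) (k - 2) - binom_sum (card {1..n} - 6) (k - 2))"
    proof (rule disjoint_pairs_bound[OF finite_U card_U k F_sub G_sub _ extremal(1)])
      show "cross_intersecting \<F>' \<G>'" using members_meet unfolding cross_intersecting_def by blast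
      show "{a, b, c, d} \<subseteq> {1..n}" using CF_D[OF extremal(2)] CF_D[OF extremal(3)] by blast
      show "{a, c} \<inter> F \<noteq> {} \<and> {b, d} \<inter> F \<noteq> {}" if "F \<in> \<F>'" for F
        using that extremal(4,5) by (simp add: min_covers_def)
      show "{a, b} \<inter> G \<noteq> {} \<and> {c, d} \<inter> G \<noteq> {}" if "G \<in> \<G>'" for G
        using that extremal(2,3) by (simp add: min_covers_def)
    qed
    then show ?thesis using le ge by simp
  qed
qed

end
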